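(* Let $\beta=(\beta_1,\ldots,\beta_{2\ell+1})$ be a composition with an odd number of parts and let $k\ge0$ be any integer. Then the map $\Phi$ defined by steps (PH1)–(PH3) below is a bijection from the set $\mathcal{I}^r_k(\beta)$ of restricted lower order ideals of the fence $F(\beta)$ with $k$ elements to the set $\mathcal{U}^r_k(\beta)$ of restricted filters of $F(\beta)$ with $k$ elements.
   Context: The fence $F(\beta)$ is obtained from chains $S_1,\dots,S_{2\ell+1}$ with $\#S_i=\beta_i+1$ by identifying the maximal elements of $S_i,S_{i+1}$ for $i$ odd and the minimal elements for $i$ even. Ascending segments: $A_j=S_{2j-1}$ ($1\le j\le\ell+1$); descending segments: $D_i=S_{2i}$ ($1\le i\le\ell$). An element is shared if it lies on two segments. Let $\tilde A_j$ be the unshared elements of $A_j$, $\alpha_j=1+\#\tilde A_j$ (so $\alpha_1=\beta_1+1$, $\alpha_{\ell+1}=\beta_{2\ell+1}+1$, $\alpha_j=\beta_{2j-1}$ otherwise), $\delta_i=\beta_{2i}$, so $\#D_i=\delta_i+1$. A lower order ideal $I$ is encoded by $a_j=\#(I\cap\tilde A_j)$, $d_i=\#(I\cap D_i)$; a filter $U$ by $b_j=\#(U\cap\tilde A_j)$, $e_i=\#(U\cap D_i)$. The ideal $I$ is restricted if $d_1\le\delta_1$, and either $d_\ell\neq1$ or $a_{\ell+1}<\alpha_{\ell+1}-1$. The filter $U$ is restricted if $e_\ell\le\delta_\ell$, and either $e_1\neq1$ or $b_1<\alpha_1-1$. (For $\ell=0$ these conditions are vacuous.) Map $\phi$ on finite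 sequences of nonnegative integers: a block is a maximal run of consecutive positive entries; its trailing ones $T$ is its maximal (possibly empty) final segment of ones; $B'$ is the block with $T$ removed; (P1) for each block with nonempty $T$, exchange $T$ with the $0$ immediately following it; (P2) for each block with $\#B'\ge2$, decrease the last entry of $B'$ by $1$ and increase its first entry by $1$. $\Phi$: given $I$ encoded by $(a,d)$: (PH1) for every $i\in[\ell]$ with $d_i=1$ and $a_{i+1}<\alpha_{i+1}-1$, set $d_i:=0$, $a_{i+1}:=a_{i+1}+1$. (PH2) Split $d_1,\ldots,d_\ell$ into factors by cutting between $d_{i-1}$ and $d_i$ for each $i\in[2,\ell]$ with $a_i<\alpha_i-1$; apply $\phi$ to each factor and concatenate to get $e$; set $b:=a$. (PH3) For every $i\in[\ell]$ with $e_i=0$ and $b_i>0$, set $e_i:=1$, $b_i:=b_i-1$. $\Phi(I)$ is the filter encoded by $(b,e)$. *)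

theory Defs
  imports Main
begin

text \<open>
  The fence of a composition \<open>\<beta>\<close> is modelled on \<open>{0..sum_list \<beta>}\<close>, numbering the elements
  consecutively along the fence from left to right. With all lists of parameters written with
  indices from 1, the segment \<open>S\<^sub>i\<close> is the interval between the partial sums
  \<open>\<beta>\<^sub>1 + \<dots> + \<beta>\<^bsub>i-1\<^esub>\<close> and \<open>\<beta>\<^sub>1 + \<dots> + \<beta>\<^sub>i\<close>, so consecutive segments overlap in exactly one point,
  which is the element obtained by identification. Segments with odd index ascend with the
  numbering, segments with even index descend.
\<close>

definition junction :: "nat list \<Rightarrow> nat \<Rightarrow> nat" where
  "junction \<beta> i = sum_list (take i \<beta>)"

definition segment :: "nat list \<Rightarrow> nat \<Rightarrow> nat set" where
  "segment \<beta> i = {junction \<beta> (i - 1)..junction \<beta> i}"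

definition fence :: "nat list \<Rightarrow> nat set" where
  "fence \<beta> = (\<Union>i\<in>{1..length \<beta>}. segment \<beta> i)"

definition fence_le :: "nat list \<Rightarrow> nat \<Rightarrow> nat \<Rightarrow> bool" where
  "fence_le \<beta> x y \<longleftrightarrow> (\<exists>i\<in>{1..length \<beta>}. x \<in> segment \<beta> i \<and> y \<in> segment \<beta> i \<and>
     (if odd i then x \<le> y else y \<le> x))"

definition fence_ideals :: "nat list \<Rightarrow> nat set set" where
  "fence_ideals \<beta> = {I. I \<subseteq> fence \<beta> \<and> (\<forall>y\<in>I. \<forall>x\<in>fence \<beta>. fence_le \<beta> x y \<longrightarrow> x \<in> I)}"

definition fence_filters :: "nat list \<Rightarrow> nat set set" where
  "fence_filters \<beta> = {U. U \<subseteq> fence \<beta> \<and> (\<forall>x\<in>U. \<forall>y\<in>fence \<beta>. fence_le \<beta> x y \<longrightarrow> y \<in> U)}"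

text \<open>The number \<open>\<ell>\<close>, where \<open>\<beta>\<close> has \<open>2\<ell> + 1\<close> parts.\<close>

definition ell :: "nat list \<Rightarrow> nat" where
  "ell \<beta> = length \<beta> div 2"

definition asc :: "nat list \<Rightarrow> nat \<Rightarrow> nat set" where
  "asc \<beta> j = segment \<beta> (2 * j - 1)"

definition desc :: "nat list \<Rightarrow> nat \<Rightarrow> nat set" where
  "desc \<beta> i = segment \<beta> (2 * i)"

definition shared :: "nat list \<Rightarrow> nat \<Rightarrow> bool" where
  "shared \<beta> x \<longleftrightarrow> (\<exists>i\<in>{1..length \<beta>}. \<exists>i'\<in>{1..length \<beta>}.
     i \<noteq> i' \<and> x \<in> segment \<beta> i \<and> x \<in> segment \<beta> i')"

definition asc_unshared :: "nat list \<Rightarrow> nat \<Rightarrow> nat set" where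
  "asc_unshared \<beta> j = {x \<in> asc \<beta> j. \<not> shared \<beta> x}"

definition alpha :: "nat list \<Rightarrow> nat \<Rightarrow> nat" where
  "alpha \<beta> j = 1 + card (asc_unshared \<beta> j)"

definition delta :: "nat list \<Rightarrow> nat \<Rightarrow> nat" where
  "delta \<beta> i = \<beta> ! (2 * i - 1)"

text \<open>
  The encoding of a set \<open>X\<close> (an ideal or a filter): \<open>acode \<beta> X j\<close> is \<open>a\<^sub>j\<close> (or \<open>b\<^sub>j\<close>) for
  \<open>1 \<le> j \<le> \<ell> + 1\<close>, and \<open>dcode \<beta> X i\<close> is \<open>d\<^sub>i\<close> (or \<open>e\<^sub>i\<close>) for \<open>1 \<le> i \<le> \<ell>\<close>.
\<close>

definition acode :: "nat list \<Rightarrow> nat set \<Rightarrow> nat \<Rightarrow> nat" where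
  "acode \<beta> X j = card (X \<inter> asc_unshared \<beta> j)"

definition dcode :: "nat list \<Rightarrow> nat set \<Rightarrow> nat \<Rightarrow> nat" where
  "dcode \<beta> X i = card (X \<inter> desc \<beta> i)"

definition restricted_ideal :: "nat list \<Rightarrow> nat set \<Rightarrow> bool" where
  "restricted_ideal \<beta> I \<longleftrightarrow> I \<in> fence_ideals \<beta> \<and>
     (ell \<beta> \<ge> 1 \<longrightarrow>
        dcode \<beta> I 1 \<le> delta \<beta> 1 \<and>
        (dcode \<beta> I (ell \<beta>) \<noteq> 1 \<or> acode \<beta> I (ell \<beta> + 1) < alpha \<beta> (ell \<beta> + 1) - 1))"

definition restricted_filter :: "nat list \<Rightarrow> nat set \<Rightarrow> bool" where
  "restricted_filter \<beta> U \<longleftrightarrow> U \<in> fence_filters \<beta> \<and>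
     (ell \<beta> \<ge> 1 \<longrightarrow>
        dcode \<beta> U (ell \<beta>) \<le> delta \<beta> (ell \<beta>) \<and>
        (dcode \<beta> U 1 \<noteq> 1 \<or> acode \<beta> U 1 < alpha \<beta> 1 - 1))"

definition restricted_ideals :: "nat list \<Rightarrow> nat \<Rightarrow> nat set set" where
  "restricted_ideals \<beta> k = {I. restricted_ideal \<beta> I \<and> card I = k}"

definition restricted_filters :: "nat list \<Rightarrow> nat \<Rightarrow> nat set set" where
  "restricted_filters \<beta> k = {U. restricted_filter \<beta> U \<and> card U = k}"

text \<open>The trailing ones \<open>T\<close> of a block \<open>B\<close>, and the block \<open>B'\<close> with \<open>T\<close> removed.\<close>

definition trailing_ones :: "nat list \<Rightarrow> nat list" where
  "trailing_ones B = rev (takeWhile (\<lambda>x. x = 1) (rev B))"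

definition drop_trailing_ones :: "nat list \<Rightarrow> nat list" where
  "drop_trailing_ones B = rev (dropWhile (\<lambda>x. x = 1) (rev B))"

definition shift_unit :: "nat list \<Rightarrow> nat list" where
  "shift_unit B =
     (if length B \<ge> 2 then (hd B + 1) # butlast (tl B) @ [last B - 1] else B)"

text \<open>
  The map \<open>\<phi>\<close> processes the blocks of the given sequence from left to right. A block followed by
  a \<open>0\<close> is rewritten from \<open>B' T 0\<close> to \<open>B' 0 T\<close>, moving one unit from the end of \<open>B'\<close> to
  its start; if \<open>T\<close> is empty the exchange is the identity. A block at the very end of the sequence has no \<open>0\<close> to exchange with,
  so its trailing ones stay in place; this is a convention only, since \<open>\<phi>\<close> is applied below to factors that
  do not end in a \<open>1\<close>.
\<close>

function phi :: "nat list \<Rightarrow> nat list" where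
  "phi [] = []"
| "phi (0 # xs) = 0 # phi xs"
| "phi (Suc x # xs) =
     (let B = takeWhile (\<lambda>y. y > 0) (Suc x # xs);
          R = dropWhile (\<lambda>y. y > 0) (Suc x # xs);
          T = trailing_ones B;
          B' = drop_trailing_ones B
      in if R = [] then shift_unit B' @ T
         else shift_unit B' @ [0] @ T @ phi (tl R))"
  by pat_completeness auto
termination
proof (relation "measure length", goal_cases)
  case (3 x xs)
  then show ?case
    using length_dropWhile_le[of "\<lambda>y. y > 0" xs] by (simp add: le_imp_less_Suc)
qed auto

text \<open>
  \<open>factors c i xs\<close> splits \<open>xs\<close>, whose entries are numbered \<open>i, i + 1, \<dots>\<close>, by cutting just
  before every entry (other than the first one) whose number satisfies \<open>c\<close>.
\<close>

fun factors :: "(nat \<Rightarrow> bool) \<Rightarrow> nat \<Rightarrow> 'a list \<Rightarrow> 'a list list" where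
  "factors c i [] = []"
| "factors c i [x] = [[x]]"
| "factors c i (x # y # ys) =
     (let fs = factors c (i + 1) (y # ys)
      in if c (i + 1) then [x] # fs else (x # hd fs) # tl fs)"

text \<open>
  All conditions within one step refer to the values before the
  step; different \<open>i\<close> touch different entries.
\<close>

definition PH1 :: "nat list \<Rightarrow> (nat \<Rightarrow> nat) \<times> (nat \<Rightarrow> nat) \<Rightarrow> (nat \<Rightarrow> nat) \<times> (nat \<Rightarrow> nat)" where
  "PH1 \<beta> = (\<lambda>(a, d).
     let act = (\<lambda>i. i \<in> {1..ell \<beta>} \<and> d i = 1 \<and> a (i + 1) < alpha \<beta> (i + 1) - 1)
     in (\<lambda>j. if act (j - 1) then a j + 1 else a j,
         \<lambda>i. if act i then 0 else d i))"

definition PH2 :: "nat list \<Rightarrow> (nat \<Rightarrow> nat) \<times> (nat \<Rightarrow> nat) \<Rightarrow> (nat \<Rightarrow> nat) \<times> (nat \<Rightarrow> nat)" where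
  "PH2 \<beta> = (\<lambda>(a, d).
     let ds = map d [1..<ell \<beta> + 1];
         es = concat (map phi (factors (\<lambda>i. a i < alpha \<beta> i - 1) 1 ds))
     in (a, \<lambda>i. es ! (i - 1)))"

definition PH3 :: "nat list \<Rightarrow> (nat \<Rightarrow> nat) \<times> (nat \<Rightarrow> nat) \<Rightarrow> (nat \<Rightarrow> nat) \<times> (nat \<Rightarrow> nat)" where
  "PH3 \<beta> = (\<lambda>(b, e).
     let act = (\<lambda>i. i \<in> {1..ell \<beta>} \<and> e i = 0 \<and> b i > 0)
     in (\<lambda>j. if act j then b j - 1 else b j,
         \<lambda>i. if act i then 1 else e i))"

definition encodes :: "nat list \<Rightarrow> nat set \<Rightarrow> (nat \<Rightarrow> nat) \<times> (nat \<Rightarrow> nat) \<Rightarrow> bool" where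
  "encodes \<beta> X = (\<lambda>(b, e).
     (\<forall>j\<in>{1..ell \<beta> + 1}. acode \<beta> X j = b j) \<and> (\<forall>i\<in>{1..ell \<beta>}. dcode \<beta> X i = e i))"

definition Phi :: "nat list \<Rightarrow> nat set \<Rightarrow> nat set" where
  "Phi \<beta> I = (THE U. U \<in> fence_filters \<beta> \<and>
     encodes \<beta> U (PH3 \<beta> (PH2 \<beta> (PH1 \<beta> (acode \<beta> I, dcode \<beta> I)))))"

text \<open>
  The model agrees with the gluing construction: the segments are chains of the right sizes,
  consecutive ones meet in a common maximum or minimum, and other pairs of segments are disjoint.
\<close>

lemma junction_mono: "i \<le> j \<Longrightarrow> junction \<beta> i \<le> junction \<beta> j"
  unfolding junction_def
  by (metis le_add1 min.absorb2 sum_list.append take_add take_take le_Suc_ex)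

lemma junction_Suc: "i < length \<beta> \<Longrightarrow> junction \<beta> (Suc i) = junction \<beta> i + \<beta> ! i"
  by (simp add: junction_def take_Suc_conv_app_nth)

lemma junction_strict_mono:
  assumes "\<forall>x\<in>set \<beta>. 0 < x" "i < j" "j \<le> length \<beta>"
  shows "junction \<beta> i < junction \<beta> j"
proof -
  have "junction \<beta> i < junction \<beta> (Suc i)"
    using assms by (simp add: junction_Suc)
  also have "\<dots> \<le> junction \<beta> j"
    using assms by (intro junction_mono) simp
  finally show ?thesis .
qed

lemma card_segment: "i \<in> {1..length \<beta>} \<Longrightarrow> card (segment \<beta> i) = \<beta> ! (i - 1) + 1"
  using junction_Suc[of "i - 1" \<beta>] by (auto simp: segment_def)

lemma segment_Int_Suc:
  assumes "i \<ge> 1"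
  shows "segment \<beta> i \<inter> segment \<beta> (Suc i) = {junction \<beta> i}"
  using junction_mono[of "i - 1" i \<beta>] junction_mono[of i "Suc i" \<beta>]
  by (auto simp: segment_def)

lemma segment_disjoint:
  assumes "\<forall>x\<in>set \<beta>. 0 < x" "1 \<le> i" "Suc i < j" "j \<le> length \<beta>"
  shows "segment \<beta> i \<inter> segment \<beta> j = {}"
proof -
  have "junction \<beta> i < junction \<beta> (j - 1)"
    using assms by (intro junction_strict_mono) auto
  then show ?thesis by (auto simp: segment_def)
qed

lemma fence_eq:
  assumes "\<beta> \<noteq> []"
  shows "fence \<beta> = {0..sum_list \<beta>}"
proof -
  have "(\<Union>i\<in>{1..n}. segment \<beta> i) = {0..junction \<beta> n}" if "n \<ge> 1" for n
    using that
  proof (induction n rule: dec_induct)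
    case base
    then show ?case by (simp add: segment_def junction_def)
  next
    case (step n)
    have "{1..Suc n} = insert (Suc n) {1..n}" by auto
    then have "(\<Union>i\<in>{1..Suc n}. segment \<beta> i) = {junction \<beta> n..junction \<beta> (Suc n)} \<union> {0..junction \<beta> n}"
      using step.IH by (simp add: segment_def)
    then show ?case using junction_mono[of n "Suc n" \<beta>] by auto
  qed
  from this[of "length \<beta>"] assms show ?thesis
    by (simp add: fence_def junction_def Suc_le_eq)
qed

lemma fence_le_antisym:
  assumes "\<forall>x\<in>set \<beta>. 0 < x" "fence_le \<beta> x y" "fence_le \<beta> y x"
  shows "x = y"
proof -
  have *: "x = y" if "1 \<le> i" "i < j" "j \<le> length \<beta>"
    "x \<in> segment \<beta> i" "y \<in> segment \<beta> i" "x \<in> segment \<beta> j" "y \<in> segment \<beta> j" for i j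
  proof (cases "j = Suc i")
    case True
    then have "x \<in> {junction \<beta> i}" "y \<in> {junction \<beta> i}"
      using segment_Int_Suc[OF that(1), of \<beta>] that by blast+
    then show ?thesis by simp
  next
    case False
    then show ?thesis using segment_disjoint[OF assms(1) that(1) _ that(3)] that by fastforce
  qed
  from assms(2,3) obtain i j where
    "1 \<le> i" "i \<le> length \<beta>" "1 \<le> j" "j \<le> length \<beta>"
    "x \<in> segment \<beta> i" "y \<in> segment \<beta> i" "x \<in> segment \<beta> j" "y \<in> segment \<beta> j"
    "if odd i then x \<le> y else y \<le> x" "if odd j then y \<le> x else x \<le> y"
    by (auto simp: fence_le_def)
  then show ?thesis
    using *[of i j] *[of j i] by (cases i j rule: linorder_cases) (auto split: if_splits)
qed

lemma fence_le_trans: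
  assumes "\<forall>x\<in>set \<beta>. 0 < x" "fence_le \<beta> x y" "fence_le \<beta> y z"
  shows "fence_le \<beta> x z"
proof -
  from assms(2,3) obtain i j where ij:
    "1 \<le> i" "i \<le> length \<beta>" "1 \<le> j" "j \<le> length \<beta>"
    "x \<in> segment \<beta> i" "y \<in> segment \<beta> i" "y \<in> segment \<beta> j" "z \<in> segment \<beta> j"
    "if odd i then x \<le> y else y \<le> x" "if odd j then y \<le> z else z \<le> y"
    by (auto simp: fence_le_def)
  consider "i = j" | "j = Suc i" | "i = Suc j" | "Suc i < j" | "Suc j < i" by linarith
  then show ?thesis
  proof cases
    case 1
    then show ?thesis using ij unfolding fence_le_def
      by (intro bexI[of _ i]) (auto split: if_splits)
  next
    case 2
    then have "y = junction \<beta> i" using segment_Int_Suc[of i \<beta>] ij by blast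
    then have "x = y \<or> y = z" using ij 2 by (auto simp: segment_def split: if_splits)
    then show ?thesis using assms by auto
  next
    case 3
    then have "y = junction \<beta> j" using segment_Int_Suc[of j \<beta>] ij by blast
    then have "x = y \<or> y = z" using ij 3 by (auto simp: segment_def split: if_splits)
    then show ?thesis using assms by auto
  next
    case 4
    then show ?thesis using segment_disjoint[OF assms(1), of i j] ij by auto
  next
    case 5
    then show ?thesis using segment_disjoint[OF assms(1), of j i] ij by auto
  qed
qed

lemma partial_order_on_fence:
  assumes "\<forall>x\<in>set \<beta>. 0 < x"
  shows "partial_order_on (fence \<beta>) {(x, y). fence_le \<beta> x y}"
  unfolding partial_order_on_def preorder_on_def
proof (intro conjI)
  show "refl_on (fence \<beta>) {(x, y). fence_le \<beta> x y}"
    by (auto simp: refl_on_def fence_def fence_le_def)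
  show "trans {(x, y). fence_le \<beta> x y}"
    using fence_le_trans[OF assms] by (auto intro!: transI)
  show "antisym {(x, y). fence_le \<beta> x y}"
    using fence_le_antisym[OF assms] by (auto intro!: antisymI)
  show "{(x, y). fence_le \<beta> x y} \<subseteq> fence \<beta> \<times> fence \<beta>"
    by (auto simp: fence_def fence_le_def)
qed

lemma segment_Int_Suc_extremal:
  assumes "x \<in> segment \<beta> i \<union> segment \<beta> (Suc i)" "1 \<le> i" "Suc i \<le> length \<beta>"
  shows "if odd i then fence_le \<beta> x (junction \<beta> i) else fence_le \<beta> (junction \<beta> i) x"
proof -
  have J: "junction \<beta> i \<in> segment \<beta> i" "junction \<beta> i \<in> segment \<beta> (Suc i)"
    using segment_Int_Suc[OF assms(2), of \<beta>] by auto
  from assms(1) show ?thesis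
  proof
    assume "x \<in> segment \<beta> i"
    then show ?thesis using assms J unfolding fence_le_def
      by (auto intro!: bexI[of _ i]) (auto simp: segment_def)
  next
    assume "x \<in> segment \<beta> (Suc i)"
    then show ?thesis using assms J unfolding fence_le_def
      by (auto intro!: bexI[of _ "Suc i"]) (auto simp: segment_def)
  qed
qed

end

theory Submission
  imports Defs
begin

text \<open>
  The map \<open>\<phi>\<close> is local. Call a position \<open>i\<close> a run position if the sequence reads
  \<open>1, \<dots>, 1, 0\<close> from \<open>i\<close> on. At a run position, \<open>\<phi>\<close> writes \<open>1\<close> or \<open>0\<close> according to whether the
  preceding entry is \<open>1\<close>; at any other position it adds \<open>1\<close> if the preceding position is a run
  position or a cut and subtracts \<open>1\<close> if the following one is. The run positions are also
  those up to which the image reads \<open>0, 1, \<dots>, 1\<close>, so the formula can be inverted. As \<open>PH1\<close> and \<open>PH3\<close> can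
  be undone as well, \<open>\<Phi>\<close> is injective and hence
  \<open>#\<I>\<^sup>r\<^sub>k(\<beta>) \<le> #\<U>\<^sup>r\<^sub>k(\<beta>)\<close>. Turning the fence by 180 degrees identifies \<open>\<U>\<^sup>r\<^sub>k(\<beta>)\<close> with
  \<open>\<I>\<^sup>r\<^sub>k(rev \<beta>)\<close>, which gives the reverse inequality, and an injection between finite sets of
  equal size is a bijection.
\<close>

section \<open>A local description of the map on sequences\<close>

text \<open>The restrictions are what makes the local formula reversible. A one before a cut or at
  the end of the sequence has no zero of its own factor to be exchanged with. \<open>PH1\<close>
  turns such ones into zeros, and at the right end it can always do so because of the second
  condition on restricted ideals. A full entry \<open>d i = delta \<beta> i + 1\<close> at the start
  of a block could not take another unit; for \<open>i > 1\<close> the ideal property excludes this,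
  for \<open>i = 1\<close> the first condition does. The cuts depend on \<open>a\<close> alone,
  which \<open>PH2\<close> does not change, so they are still visible in the image. Filters are
  compared with ideals of the reversed fence and not with complements, since complementing does not
  keep the number of elements. Turning the fence reverses the order, keeps the size and carries the
  restrictions on filters to those on ideals. Counting then spares the proof that the inverted
  formulas lead from restricted filters back to restricted ideals.\<close>

fun ones_then_zero :: "nat list \<Rightarrow> bool" where
  "ones_then_zero [] = True"
| "ones_then_zero (x # xs) = (x = 0 \<or> x = 1 \<and> ones_then_zero xs)"

text \<open>
  The flag \<open>p\<close> says that the entry before the list is \<open>1\<close>, the flag \<open>f\<close> that the list starts a
  new block; \<open>c\<close> holds at the numbers of the entries before which the sequence is cut.
\<close>

fun phi_local :: "(nat \<Rightarrow> bool) \<Rightarrow> nat \<Rightarrow> bool \<Rightarrow> bool \<Rightarrow> nat list \<Rightarrow> nat list" where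
  "phi_local c i p f [] = []"
| "phi_local c i p f (x # xs) =
     (if ones_then_zero (x # xs) then of_bool p
      else x + of_bool f - of_bool (c (i + 1) \<or> ones_then_zero xs))
     # phi_local c (i + 1) (x = 1) (c (i + 1) \<or> ones_then_zero (x # xs)) xs"

fun no_one_before_cut :: "(nat \<Rightarrow> bool) \<Rightarrow> nat \<Rightarrow> nat list \<Rightarrow> bool" where
  "no_one_before_cut c i [] = True"
| "no_one_before_cut c i [x] = (x \<noteq> 1)"
| "no_one_before_cut c i (x # y # ys) =
     ((c (i + 1) \<longrightarrow> x \<noteq> 1) \<and> no_one_before_cut c (i + 1) (y # ys))"

abbreviation phi_uncut :: "bool \<Rightarrow> bool \<Rightarrow> nat list \<Rightarrow> nat list" where
  "phi_uncut \<equiv> phi_local (\<lambda>_. False) 0"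

section \<open>The local formula on a single factor\<close>

lemma phi_local_uncut: "phi_local (\<lambda>_. False) i p f xs = phi_uncut p f xs"
proof -
  have "phi_local (\<lambda>_. False) i p f xs = phi_local (\<lambda>_. False) j p f xs" for j
  proof (induction xs arbitrary: i j p f)
    case (Cons x xs)
    show ?case
      unfolding phi_local.simps by (intro arg_cong2[where f = Cons] refl Cons.IH)
  qed simp
  then show ?thesis .
qed

lemma phi_uncut_Cons:
  "phi_uncut p f (x # xs) =
     (if ones_then_zero (x # xs) then of_bool p else x + of_bool f - of_bool (ones_then_zero xs))
     # phi_uncut (x = 1) (ones_then_zero (x # xs)) xs"
  by (simp add: phi_local_uncut[of "Suc 0"])

lemma phi_uncut_first_irrelevant:
  "ones_then_zero xs \<Longrightarrow> phi_uncut p f xs = phi_uncut p f' xs"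
  by (cases xs) simp_all

lemma ones_then_zero_replicate: "ones_then_zero (replicate m 1 @ 0 # R)"
  by (induction m) auto

text \<open>Each position of the run reports whether its left neighbour is a one, which moves the
  ones one place to the right: this is (P1). The flag \<open>p\<close> is general because the
  induction peels off ones; after the zero the flags are those of a fresh start.\<close>

lemma phi_uncut_ones_then_zero:
  "phi_uncut p f (replicate m 1 @ 0 # R) = of_bool p # replicate m 1 @ phi_uncut False True R"
proof (induction m arbitrary: p f)
  case 0
  then show ?case by (simp add: phi_uncut_Cons del: phi_local.simps)
next
  case (Suc m)
  then show ?case
    using ones_then_zero_replicate[of m R]
    by (simp add: phi_uncut_Cons del: phi_local.simps)
qed

text \<open>Reading from the left meets an entry of at least \<open>2\<close> within
  \<open>B\<close>, before any zero.\<close>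

lemma not_ones_then_zero_append:
  assumes "\<forall>x\<in>set B. 0 < x" "B \<noteq> []" "last B \<noteq> 1"
  shows "\<not> ones_then_zero (B @ xs)"
  using assms by (induction B) (auto split: if_splits)

lemma phi_uncut_block_rest:
  assumes "\<forall>x\<in>set B. 0 < x" "B \<noteq> []" "last B \<noteq> 1" "ones_then_zero xs"
  shows "phi_uncut p False (B @ xs) = butlast B @ [last B - 1] @ phi_uncut False True xs"
  using assms
proof (induction B arbitrary: p)
  case Nil
  then show ?case by simp
next
  case (Cons x B)
  show ?case
  proof (cases "B = []")
    case True
    then show ?thesis
      using Cons.prems phi_uncut_first_irrelevant[OF Cons.prems(4)]
      by (simp add: phi_uncut_Cons del: phi_local.simps)
  next
    case False
    then have "\<not> ones_then_zero (B @ xs)"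
      using Cons.prems by (intro not_ones_then_zero_append) auto
    then show ?thesis
      using Cons False by (simp add: phi_uncut_Cons del: phi_local.simps)
  qed
qed

text \<open>This is (P2): the flag \<open>f\<close> adds the unit at the first entry, and
  \<open>phi_uncut_block_rest\<close> takes it away at the last one. In a block with a single entry
  both happen at the same place and cancel, in agreement with the length test in
  \<open>shift_unit\<close>.\<close>

lemma phi_uncut_block:
  assumes "\<forall>x\<in>set B. 0 < x" "B \<noteq> []" "last B \<noteq> 1" "ones_then_zero xs"
  shows "phi_uncut p True (B @ xs) = shift_unit B @ phi_uncut False True xs"
proof (cases B)
  case Nil
  with assms show ?thesis by simp
next
  case (Cons x B2)
  show ?thesis
  proof (cases "B2 = []")
    case True
    then show ?thesis
      using Cons assms phi_uncut_first_irrelevant[OF assms(4)]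
      by (simp add: phi_uncut_Cons shift_unit_def del: phi_local.simps)
  next
    case False
    then have "\<not> ones_then_zero (B2 @ xs)"
      using assms Cons by (intro not_ones_then_zero_append) auto
    moreover have "phi_uncut (x = 1) False (B2 @ xs)
        = butlast B2 @ [last B2 - 1] @ phi_uncut False True xs"
      using assms Cons False by (intro phi_uncut_block_rest) auto
    moreover have "2 \<le> length B"
      using Cons False by (cases B2) auto
    ultimately show ?thesis
      using Cons False assms(1)
      by (simp add: phi_uncut_Cons shift_unit_def del: phi_local.simps)
  qed
qed

lemma trailing_ones_eq_replicate: "trailing_ones B = replicate (length (trailing_ones B)) 1"
proof -
  have "\<forall>x\<in>set (trailing_ones B). x = 1"
    by (auto simp: trailing_ones_def dest: set_takeWhileD)
  then show ?thesis
    by (metis replicate_length_same)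
qed

lemma drop_trailing_ones_append: "drop_trailing_ones B @ trailing_ones B = B"
  unfolding drop_trailing_ones_def trailing_ones_def
  by (metis rev_append rev_rev_ident takeWhile_dropWhile_id)

lemma last_drop_trailing_ones:
  "drop_trailing_ones B \<noteq> [] \<Longrightarrow> last (drop_trailing_ones B) \<noteq> 1"
  unfolding drop_trailing_ones_def
  by (metis (mono_tags, lifting) hd_dropWhile last_rev rev_is_Nil_conv)

lemma phi_eq_phi_uncut: "xs = [] \<or> last xs \<noteq> 1 \<Longrightarrow> phi xs = phi_uncut False True xs"
proof (induction xs rule: phi.induct)
  case 1
  then show ?case by simp
next
  case (2 xs)
  then show ?case
    by (cases "xs = []") (simp_all add: phi_uncut_Cons del: phi_local.simps)
next
  case (3 x xs)
  let ?ys = "Suc x # xs"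
  define B where "B = takeWhile (\<lambda>y. y > 0) ?ys"
  define R where "R = dropWhile (\<lambda>y. y > 0) ?ys"
  define T where "T = trailing_ones B"
  define B' where "B' = drop_trailing_ones B"
  have ys: "?ys = B @ R" and B: "B = B' @ T"
    by (simp_all add: B_def R_def B'_def T_def drop_trailing_ones_append)
  have pos: "\<forall>y\<in>set B. 0 < y"
    unfolding B_def by (auto dest: set_takeWhileD)
  have Bne: "B \<noteq> []" by (simp add: B_def)
  obtain m where T: "T = replicate m 1"
    using trailing_ones_eq_replicate T_def by metis
  have phi: "phi ?ys = (if R = [] then shift_unit B' @ T
      else shift_unit B' @ [0] @ T @ phi (tl R))"
    unfolding B_def R_def T_def B'_def phi.simps(3) Let_def by (rule refl)
  \<comment> \<open>\<open>B'\<close> is empty if the block consists of ones only. Below,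
    \<open>zs\<close> is either the run \<open>T @ R\<close> or the end of the sequence, which also
    counts as a run.\<close>
  have block: "phi_uncut False True (B' @ zs) = shift_unit B' @ phi_uncut False True zs"
    if "ones_then_zero zs" for zs
  proof (cases "B' = []")
    case True
    then show ?thesis by (simp add: shift_unit_def)
  next
    case False
    moreover have "set B' \<subseteq> set B" by (subst B) simp
    ultimately show ?thesis
      using that pos last_drop_trailing_ones[of B, folded B'_def]
      by (intro phi_uncut_block) auto
  qed
  show ?case
  proof (cases "R = []")
    case True
    then have "last B \<noteq> 1" using 3(2) ys by auto
    then have "last (B' @ T) \<noteq> 1" using B by simp
    then have "T = []" unfolding T by (cases "m = 0") (auto simp: last_append)
    then show ?thesis
      unfolding phi using True block[of "[]"] by (simp only: ys B append_Nil2 simp_thms if_True ones_then_zero.simps phi_local.simps)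
  next
    case False
    then have hd: "hd R = 0" unfolding R_def
      using hd_dropWhile[of "\<lambda>y. 0 < y" ?ys] by simp
    then obtain R' where R: "R = 0 # R'" using False by (cases R) auto
    have "phi R' = phi_uncut False True R'"
    proof -
      have "phi (tl R) = phi_uncut False True (tl R)"
      proof (rule 3(1)[OF B_def R_def T_def B'_def False])
        show "tl R = [] \<or> last (tl R) \<noteq> 1"
          using 3(2) ys R by (auto split: if_splits)
      qed
      then show ?thesis by (simp add: R)
    qed
    moreover have "phi_uncut False True ?ys = shift_unit B' @ phi_uncut False True (T @ R)"
      unfolding ys B using block[of "T @ R"] ones_then_zero_replicate[of m R'] T R by simp
    ultimately show ?thesis
      using phi_uncut_ones_then_zero[of False True m R'] R T unfolding phi by simp
  qed
qed

section \<open>Several factors at once\<close>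

lemma factors_ne: "xs \<noteq> [] \<Longrightarrow> factors c i xs \<noteq> [] \<and> hd (factors c i xs) \<noteq> []"
  by (induction c i xs rule: factors.induct) (auto simp: Let_def)

lemma last_factor_ne_one:
  "no_one_before_cut c i xs \<Longrightarrow> F \<in> set (factors c i xs) \<Longrightarrow> F \<noteq> [] \<and> last F \<noteq> 1"
proof (induction c i xs arbitrary: F rule: factors.induct)
  case (3 c i x y ys)
  obtain G Gs where G: "factors c (i + 1) (y # ys) = G # Gs"
    using factors_ne[of "y # ys"] by (metis list.distinct(1) neq_Nil_conv)
  show ?case
    using 3 G by (auto simp: Let_def split: if_splits)
qed auto

text \<open>The last entry of the first factor is not a one, so the first entry different from
  \<open>1\<close>, which decides the matter, lies inside that factor.\<close>

lemma ones_then_zero_hd_factors: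
  "no_one_before_cut c i xs \<Longrightarrow> xs \<noteq> [] \<Longrightarrow>
     ones_then_zero (hd (factors c i xs)) = ones_then_zero xs"
  by (induction c i xs rule: factors.induct) (auto simp: Let_def)

text \<open>The state of \<open>phi_local\<close> just after a cut is \<open>p = False\<close>, as
  no one stands before a cut, and \<open>f = True\<close>, by definition. This is the state in which
  each later factor is processed on its own; only the first factor inherits arbitrary flags.\<close>

lemma phi_uncut_factors:
  assumes "no_one_before_cut c i xs" "xs \<noteq> []"
  shows "phi_uncut p f (hd (factors c i xs))
           @ concat (map (phi_uncut False True) (tl (factors c i xs))) = phi_local c i p f xs"
  using assms
proof (induction c i xs arbitrary: p f rule: factors.induct)
  case (1 c i)
  then show ?case by simp
next
  case (2 c i x)
  then show ?case by simp
next
  case (3 c i x y ys)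
  obtain G Gs where G: "factors c (i + 1) (y # ys) = G # Gs"
    using factors_ne[of "y # ys"] by (metis list.distinct(1) neq_Nil_conv)
  have t: "ones_then_zero G = ones_then_zero (y # ys)"
    using ones_then_zero_hd_factors[of c "i + 1" "y # ys"] 3(2) G by simp
  note IH = 3(1)[OF _ list.distinct(2)]
  show ?case
  proof (cases "c (i + 1)")
    case True
    have "phi_uncut False True G @ concat (map (phi_uncut False True) Gs)
        = phi_local c (i + 1) False True (y # ys)"
      using IH[of False True] G 3(2) by simp
    then show ?thesis
      using True G 3(2)
      by (subst phi_local.simps) (simp add: Let_def phi_uncut_Cons del: phi_local.simps(2))
  next
    case False
    have "phi_uncut p' f' G @ concat (map (phi_uncut False True) Gs)
        = phi_local c (i + 1) p' f' (y # ys)" for p' f'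
      using IH[of p' f'] G 3(2) by simp
    then show ?thesis
      using False G t
      by (subst phi_local.simps) (simp add: Let_def phi_uncut_Cons del: phi_local.simps(2) ones_then_zero.simps, simp)
  qed
qed

lemma concat_phi_factors:
  assumes "no_one_before_cut c i xs"
  shows "concat (map phi (factors c i xs)) = phi_local c i False True xs"
proof (cases "xs = []")
  case True
  then show ?thesis by simp
next
  case False
  have "map phi (factors c i xs) = map (phi_uncut False True) (factors c i xs)"
    using last_factor_ne_one[OF assms] by (intro map_cong refl phi_eq_phi_uncut) blast
  moreover have "factors c i xs = hd (factors c i xs) # tl (factors c i xs)"
    using factors_ne[OF False, of c i] by simp
  ultimately show ?thesis
    using phi_uncut_factors[OF assms False] by (metis concat.simps(2) list.simps(9))
qed

text \<open>The unit added at the start of a block that is not all ones is taken away again at its end,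
  so only the state \<open>p\<close>, \<open>f\<close> at the start contributes.\<close>

lemma sum_list_phi_local:
  assumes "no_one_before_cut c i xs" "xs = [] \<Longrightarrow> \<not> p"
  shows "sum_list (phi_local c i p f xs) + 1
           = sum_list xs + (if ones_then_zero xs then of_bool p + 1 else of_bool f)"
  using assms
proof (induction c i xs arbitrary: p f rule: no_one_before_cut.induct)
  case (1 c i)
  then show ?case by simp
next
  case (2 c i x)
  then show ?case by auto
next
  case (3 c i x y ys)
  let ?xs = "y # ys"
  have "sum_list (phi_local c (i + 1) p' f' ?xs) + 1
           = sum_list ?xs + (if ones_then_zero ?xs then of_bool p' + 1 else of_bool f')" for p' f'
    using 3 by (metis list.distinct(1) no_one_before_cut.simps(3))
  note IH = this[of "x = 1" "c (i + 1) \<or> ones_then_zero (x # ?xs)"]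
  show ?case
  proof (cases "ones_then_zero (x # ?xs)")
    case True
    then show ?thesis using IH by (subst phi_local.simps) (auto simp del: phi_local.simps split: if_splits)
  next
    case False
    then show ?thesis using IH by (subst phi_local.simps) (auto simp del: phi_local.simps split: if_splits)
  qed
qed

text \<open>Unrolls the recursion into a formula for each entry. After the first entry the flags
  depend on the left neighbour only, so \<open>d (k - 1)\<close> and \<open>t (k - 1)\<close>
  express them.\<close>

lemma phi_local_map:
  fixes d :: "nat \<Rightarrow> nat"
  assumes "\<And>k. t k = ones_then_zero (map d [k..<n])"
  shows "phi_local c i p f (map d [i..<n]) =
    map (\<lambda>k. if t k then of_bool (if k = i then p else d (k - 1) = 1)
             else d k + of_bool (if k = i then f else c k \<or> t (k - 1))
               - of_bool (c (k + 1) \<or> t (k + 1))) [i..<n]"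
proof (induction "n - i" arbitrary: i p f)
  case 0
  then show ?case by simp
next
  case (Suc m)
  then have "[i..<n] = i # [Suc i..<n]" by (simp add: upt_rec)
  moreover have "m = n - Suc i" using Suc(2) by simp
  note Suc(1)[OF this, of "d i = 1" "c (Suc i) \<or> t i"]
  moreover have "t i = ones_then_zero (d i # map d [Suc i..<n])"
    using assms calculation(1) by simp
  ultimately show ?case
    using assms[of "Suc i"] by (simp del: ones_then_zero.simps)
qed

lemma no_one_before_cut_map:
  assumes "\<And>k. i \<le> k \<Longrightarrow> k < n \<Longrightarrow> d k = 1 \<Longrightarrow> k + 1 < n \<and> \<not> c (k + 1)"
  shows "no_one_before_cut c i (map d [i..<n])"
  using assms
proof (induction "n - i" arbitrary: i)
  case 0
  then show ?case by simp
next
  case (Suc m)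
  have IH: "no_one_before_cut c (i + 1) (map d [i + 1..<n])"
    using Suc by (intro Suc(1)) auto
  have i: "[i..<n] = i # [i + 1..<n]" using Suc(2) by (simp add: upt_rec)
  show ?case
  proof (cases "i + 1 < n")
    case True
    then have "[i + 1..<n] = (i + 1) # [i + 2..<n]" by (simp add: upt_rec)
    moreover have "d i = 1 \<Longrightarrow> \<not> c (i + 1)" using Suc(3)[of i] True by simp
    ultimately show ?thesis using IH unfolding i by auto
  next
    case False
    moreover have "i < n" using Suc(2) by simp
    ultimately show ?thesis using Suc(3)[of i] unfolding i by auto
  qed
qed

text \<open>
  Here \<open>t i\<close> means that the sequence reads \<open>1, \<dots>, 1, 0\<close> from position \<open>i\<close> on. The end of the
  sequence counts as such a position; this is harmless because the last entry is never \<open>1\<close>.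
\<close>

definition phi_rule ::
    "nat \<Rightarrow> (nat \<Rightarrow> bool) \<Rightarrow> (nat \<Rightarrow> nat) \<Rightarrow> (nat \<Rightarrow> bool) \<Rightarrow> (nat \<Rightarrow> nat) \<Rightarrow> bool" where
  "phi_rule l c d t e \<longleftrightarrow> t (l + 1) \<and>
     (\<forall>i\<in>{1..l}. t i \<longleftrightarrow> d i = 0 \<or> d i = 1 \<and> t (i + 1)) \<and>
     (\<forall>i\<in>{1..l}. e i = (if t i then of_bool (1 < i \<and> d (i - 1) = 1)
        else d i + of_bool (i = 1 \<or> c i \<or> t (i - 1)) - of_bool (c (i + 1) \<or> t (i + 1))))"

definition no_one_before_cut_on :: "nat \<Rightarrow> (nat \<Rightarrow> bool) \<Rightarrow> (nat \<Rightarrow> nat) \<Rightarrow> bool" where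
  "no_one_before_cut_on l c d \<longleftrightarrow> (\<forall>i\<in>{1..l}. d i = 1 \<longrightarrow> i < l \<and> \<not> c (i + 1))"

text \<open>From here on lists are no longer needed: \<open>phi_rule\<close> determines
  \<open>t\<close> on \<open>{1..l + 1}\<close> by recursion from the right end, so its existence is
  all that has to be recorded.\<close>

lemma concat_phi_factors_map:
  assumes "no_one_before_cut_on l c d"
  shows "\<exists>t. phi_rule l c d t (\<lambda>i. concat (map phi (factors c 1 (map d [1..<l + 1]))) ! (i - 1))"
    and "sum_list (concat (map phi (factors c 1 (map d [1..<l + 1])))) = sum_list (map d [1..<l + 1])"
proof -
  let ?xs = "map d [1..<l + 1]"
  define t where "t k = ones_then_zero (map d [k..<l + 1])" for k
  have no: "no_one_before_cut c 1 ?xs"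
    using assms by (intro no_one_before_cut_map) (auto simp: no_one_before_cut_on_def)
  have es: "concat (map phi (factors c 1 ?xs)) = map (\<lambda>k. if t k
      then of_bool (if k = 1 then False else d (k - 1) = 1)
      else d k + of_bool (if k = 1 then True else c k \<or> t (k - 1))
        - of_bool (c (k + 1) \<or> t (k + 1))) [1..<l + 1]"
    using concat_phi_factors[OF no] phi_local_map[of t d "l + 1" c 1 False True] t_def by simp
  have "t i \<longleftrightarrow> d i = 0 \<or> d i = 1 \<and> t (i + 1)" if "i \<in> {1..l}" for i
  proof -
    have "[i..<l + 1] = i # [i + 1..<l + 1]" using that by (subst upt_rec) simp
    then show ?thesis by (simp add: t_def)
  qed
  moreover have "t (l + 1)" by (simp add: t_def)
  ultimately have "phi_rule l c d t (\<lambda>i. concat (map phi (factors c 1 ?xs)) ! (i - 1))"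
    unfolding phi_rule_def es by (auto simp: nth_append simp del: upt_Suc)
  then show "\<exists>t. phi_rule l c d t (\<lambda>i. concat (map phi (factors c 1 ?xs)) ! (i - 1))"
    by (intro exI[of _ t])
  \<comment> \<open>With the initial flags \<open>False\<close> and \<open>True\<close> both cases
    of \<open>sum_list_phi_local\<close> contribute exactly \<open>1\<close>, which cancels.\<close>
  show "sum_list (concat (map phi (factors c 1 ?xs))) = sum_list ?xs"
    using sum_list_phi_local[OF no, of False True] concat_phi_factors[OF no]
    by (simp del: upt_Suc split: if_splits)
qed

lemma length_phi_local: "length (phi_local c i p f xs) = length xs"
  by (induction xs arbitrary: i p f) auto

section \<open>Inverting the local formula\<close>

context
  fixes l c d t e
  assumes rule: "phi_rule l c d t e" and gap: "no_one_before_cut_on l c d"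
begin

lemma phi_rule_t: "i \<in> {1..l} \<Longrightarrow> t i \<longleftrightarrow> d i = 0 \<or> d i = 1 \<and> t (i + 1)"
  using rule unfolding phi_rule_def by blast

lemma phi_rule_in_run: "i \<in> {1..l} \<Longrightarrow> t i \<Longrightarrow> e i = of_bool (1 < i \<and> d (i - 1) = 1)"
  using rule unfolding phi_rule_def by auto

text \<open>A one followed by a run would itself belong to the run, and a one before a cut is
  excluded by \<open>gap\<close>. So an entry that loses a unit is at least \<open>2\<close>, and
  the image stays positive throughout a block.\<close>

lemma phi_rule_in_block:
  assumes "i \<in> {1..l}" "\<not> t i"
  shows "e i = d i + of_bool (i = 1 \<or> c i \<or> t (i - 1)) - of_bool (c (i + 1) \<or> t (i + 1))"
    and "d i \<ge> 1 + of_bool (c (i + 1) \<or> t (i + 1))"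
proof -
  show "e i = d i + of_bool (i = 1 \<or> c i \<or> t (i - 1)) - of_bool (c (i + 1) \<or> t (i + 1))"
    using rule assms unfolding phi_rule_def by auto
  have "d i \<noteq> 0" "d i = 1 \<Longrightarrow> \<not> t (i + 1) \<and> \<not> c (i + 1)"
    using phi_rule_t[OF assms(1)] assms gap unfolding no_one_before_cut_on_def by auto
  then show "d i \<ge> 1 + of_bool (c (i + 1) \<or> t (i + 1))"
    by (cases "d i = 1") auto
qed

lemma phi_rule_block_bounds:
  assumes "i \<in> {1..l}" "\<not> t i"
  shows "0 < e i" "i = 1 \<or> c i \<or> t (i - 1) \<Longrightarrow> 1 < e i"
  using phi_rule_in_block[OF assms] by auto

text \<open>In the image a run is recognised from its left end. The block entry just after a run has
  gained a unit and is at least \<open>2\<close>, so it cannot be mistaken for a continuation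
  \<open>1\<close> of the run.\<close>

lemma phi_rule_run_iff:
  assumes "i \<in> {1..l}"
  shows "t i \<longleftrightarrow> e i = 0 \<or> e i = 1 \<and> 1 < i \<and> t (i - 1)"
proof (cases "t i")
  case True
  have "t (i - 1)" if "1 < i" "d (i - 1) = 1"
  proof -
    have "i - 1 \<in> {1..l}" using that assms by auto
    then show ?thesis using phi_rule_t[of "i - 1"] that True by auto
  qed
  then show ?thesis using phi_rule_in_run[OF assms True] True by auto
next
  case False
  then show ?thesis using phi_rule_in_block[OF assms False] by auto
qed

text \<open>In a run the ones move back one place to the left. In a block the added and the
  subtracted unit change roles, which is sound because the bound in \<open>phi_rule_in_block\<close>
  rules out truncation.\<close>

lemma phi_rule_inverse:
  assumes "i \<in> {1..l}"
  shows "d i = (if t i then of_bool (i < l \<and> e (i + 1) = 1)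
    else e i + of_bool (c (i + 1) \<or> t (i + 1)) - of_bool (i = 1 \<or> c i \<or> t (i - 1)))"
proof (cases "t i")
  case True
  show ?thesis
  proof (cases "d i = 1")
    case one: True
    then have "i < l" "t (i + 1)"
      using True phi_rule_t[OF assms] gap assms unfolding no_one_before_cut_on_def by auto
    then show ?thesis using phi_rule_in_run[of "i + 1"] assms True one by auto
  next
    case False
    then have "d i = 0" using True phi_rule_t[OF assms] by auto
    moreover have "e (i + 1) \<noteq> 1" if "i < l"
      using phi_rule_in_run[of "i + 1"] phi_rule_in_block[of "i + 1"] that True \<open>d i = 0\<close>
      by (cases "t (i + 1)") auto
    ultimately show ?thesis using True by auto
  qed
next
  case False
  then show ?thesis using phi_rule_in_block[OF assms False] by auto
qed

end

text \<open>By \<open>phi_rule_run_iff\<close> the image determines the run positions from left to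
  right, and with these and the common cuts the inverse formula returns the same entries.\<close>

lemma phi_rule_inj:
  assumes "phi_rule l c d t e" "no_one_before_cut_on l c d"
    and "phi_rule l c' d' t' e'" "no_one_before_cut_on l c' d'"
    and c: "\<And>i. i \<in> {1..l + 1} \<Longrightarrow> c i = c' i" and e: "\<And>i. i \<in> {1..l} \<Longrightarrow> e i = e' i"
    and "i \<in> {1..l}"
  shows "d i = d' i"
proof -
  have "t j = t' j" if "j \<in> {1..l}" for j
    using that
  proof (induction j)
    case (Suc j)
    then show ?case
      using phi_rule_run_iff[OF assms(1,2), of "Suc j"] phi_rule_run_iff[OF assms(3,4), of "Suc j"] e[of "Suc j"]
      by (cases "j = 0") auto
  qed simp
  moreover have "t (l + 1) = t' (l + 1)"
    using assms(1,3) unfolding phi_rule_def by blast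
  ultimately have t: "t j = t' j" if "j \<in> {1..l + 1}" for j
    using that by (cases "j = l + 1") auto
  \<comment> \<open>Nothing is known about \<open>t 0\<close>; the formula consults it only under
    \<open>i = 1\<close>, where its value does not matter.\<close>
  have "i = 1 \<or> t (i - 1) = t' (i - 1)" using t[of "i - 1"] assms(7) by force
  then show ?thesis
    unfolding phi_rule_inverse[OF assms(1,2,7)] phi_rule_inverse[OF assms(3,4,7)]
    using t[of i] t[of "i + 1"] c[of i] c[of "i + 1"] e[of i] e[of "i + 1"] assms(7) by auto
qed

section \<open>The three steps on encodings\<close>

abbreviation cap :: "nat list \<Rightarrow> nat \<Rightarrow> nat" where
  "cap \<beta> j \<equiv> alpha \<beta> j - 1"

text \<open>The minimum of \<open>D_i\<close> is also that of \<open>A_(i+1)\<close>, so an ideal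
  with an element in the latter has one in \<open>D_i\<close>. If it contains all of
  \<open>D_i\<close>, it contains the common maximum with \<open>A_i\<close>, hence
  \<open>A_i\<close> and the minimum that \<open>A_i\<close> shares with
  \<open>D_(i-1)\<close>.\<close>

definition ideal_code :: "nat list \<Rightarrow> (nat \<Rightarrow> nat) \<times> (nat \<Rightarrow> nat) \<Rightarrow> bool" where
  "ideal_code \<beta> = (\<lambda>(a, d).
     (\<forall>j\<in>{1..ell \<beta> + 1}. a j \<le> cap \<beta> j) \<and>
     (\<forall>i\<in>{1..ell \<beta>}. d i \<le> delta \<beta> i + 1 \<and> (0 < a (i + 1) \<longrightarrow> 0 < d i) \<and>
        (d i = delta \<beta> i + 1 \<longrightarrow> a i = cap \<beta> i \<and> (1 < i \<longrightarrow> 0 < d (i - 1)))))"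

text \<open>The dual conditions. For filters they are shown to be sufficient as well, because
  \<open>Phi\<close> needs a filter with the computed code.\<close>

definition filter_code :: "nat list \<Rightarrow> (nat \<Rightarrow> nat) \<times> (nat \<Rightarrow> nat) \<Rightarrow> bool" where
  "filter_code \<beta> = (\<lambda>(b, e).
     (\<forall>j\<in>{1..ell \<beta> + 1}. b j \<le> cap \<beta> j) \<and>
     (\<forall>i\<in>{1..ell \<beta>}. e i \<le> delta \<beta> i + 1 \<and> (0 < b i \<longrightarrow> 0 < e i) \<and>
        (e i = delta \<beta> i + 1 \<longrightarrow> b (i + 1) = cap \<beta> (i + 1) \<and> (i < ell \<beta> \<longrightarrow> 0 < e (i + 1)))))"

definition restricted_ideal_code :: "nat list \<Rightarrow> (nat \<Rightarrow> nat) \<times> (nat \<Rightarrow> nat) \<Rightarrow> bool" where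
  "restricted_ideal_code \<beta> = (\<lambda>(a, d). ideal_code \<beta> (a, d) \<and>
     (1 \<le> ell \<beta> \<longrightarrow> d 1 \<le> delta \<beta> 1 \<and> (d (ell \<beta>) \<noteq> 1 \<or> a (ell \<beta> + 1) < cap \<beta> (ell \<beta> + 1))))"

definition restricted_filter_code :: "nat list \<Rightarrow> (nat \<Rightarrow> nat) \<times> (nat \<Rightarrow> nat) \<Rightarrow> bool" where
  "restricted_filter_code \<beta> = (\<lambda>(b, e). filter_code \<beta> (b, e) \<and>
     (1 \<le> ell \<beta> \<longrightarrow> e (ell \<beta>) \<le> delta \<beta> (ell \<beta>) \<and> (e 1 \<noteq> 1 \<or> b 1 < cap \<beta> 1)))"

text \<open>
  Invariants after \<open>PH1\<close> and after \<open>PH2\<close>. The condition on \<open>d i = 1\<close> says that no factor ends in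
  \<open>1\<close>; the one on \<open>e i = 1\<close> says that no factor starts with \<open>1\<close>, which makes the positions changed
  by \<open>PH3\<close> recognisable.
\<close>

definition PH1_code :: "nat list \<Rightarrow> (nat \<Rightarrow> nat) \<times> (nat \<Rightarrow> nat) \<Rightarrow> bool" where
  "PH1_code \<beta> = (\<lambda>(a, d).
     (\<forall>j\<in>{1..ell \<beta> + 1}. a j \<le> cap \<beta> j) \<and>
     (\<forall>i\<in>{1..ell \<beta>}. d i \<le> delta \<beta> i + 1 \<and>
        (d i = 1 \<longrightarrow> i < ell \<beta> \<and> a (i + 1) = cap \<beta> (i + 1)) \<and>
        (d i = delta \<beta> i + 1 \<longrightarrow> 1 < i \<and> a i = cap \<beta> i \<and> 0 < d (i - 1))))"

definition PH2_code :: "nat list \<Rightarrow> (nat \<Rightarrow> nat) \<times> (nat \<Rightarrow> nat) \<Rightarrow> bool" where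
  "PH2_code \<beta> = (\<lambda>(b, e).
     (\<forall>j\<in>{1..ell \<beta> + 1}. b j \<le> cap \<beta> j) \<and>
     (\<forall>i\<in>{1..ell \<beta>}. e i \<le> delta \<beta> i + 1 \<and>
        (e i = 1 \<longrightarrow> 1 < i \<and> b i = cap \<beta> i) \<and>
        (e i = delta \<beta> i + 1 \<longrightarrow> i < ell \<beta> \<and> b (i + 1) = cap \<beta> (i + 1) \<and> 0 < e (i + 1))))"

text \<open>Codes are total functions whose values outside the index ranges are meaningless, so
  equality of pairs would be too strong.\<close>

definition same_code ::
    "nat list \<Rightarrow> (nat \<Rightarrow> nat) \<times> (nat \<Rightarrow> nat) \<Rightarrow> (nat \<Rightarrow> nat) \<times> (nat \<Rightarrow> nat) \<Rightarrow> bool" where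
  "same_code \<beta> = (\<lambda>(a, d) (a', d').
     (\<forall>j\<in>{1..ell \<beta> + 1}. a j = a' j) \<and> (\<forall>i\<in>{1..ell \<beta>}. d i = d' i))"

definition code_size :: "nat list \<Rightarrow> (nat \<Rightarrow> nat) \<times> (nat \<Rightarrow> nat) \<Rightarrow> nat" where
  "code_size \<beta> = (\<lambda>(a, d). (\<Sum>j=1..ell \<beta> + 1. a j) + (\<Sum>i=1..ell \<beta>. d i))"

text \<open>A one that survives \<open>PH1\<close> has a full \<open>a (i + 1)\<close>, which the
  second restriction forbids for \<open>i = ell \<beta>\<close>. The first restriction keeps a full
  \<open>d i\<close> away from \<open>i = 1\<close>.\<close>

lemma PH1_code_PH1:
  assumes "restricted_ideal_code \<beta> x" "\<forall>i\<in>{1..ell \<beta>}. 0 < delta \<beta> i"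
  shows "PH1_code \<beta> (PH1 \<beta> x)"
proof -
  obtain a d where x: "x = (a, d)" by (cases x)
  define act where "act i \<longleftrightarrow> i \<in> {1..ell \<beta>} \<and> d i = 1 \<and> a (i + 1) < cap \<beta> (i + 1)" for i
  define a' where "a' = (\<lambda>j. if act (j - 1) then a j + 1 else a j)"
  define d' where "d' = (\<lambda>i. if act i then 0 else d i)"
  have PH1: "PH1 \<beta> x = (a', d')"
    by (simp add: x PH1_def a'_def d'_def act_def Let_def)
  have code: "\<forall>j\<in>{1..ell \<beta> + 1}. a j \<le> cap \<beta> j"
    "\<forall>i\<in>{1..ell \<beta>}. d i \<le> delta \<beta> i + 1 \<and> (0 < a (i + 1) \<longrightarrow> 0 < d i) \<and>
        (d i = delta \<beta> i + 1 \<longrightarrow> a i = cap \<beta> i \<and> (1 < i \<longrightarrow> 0 < d (i - 1)))"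
    "1 \<le> ell \<beta> \<longrightarrow> d 1 \<le> delta \<beta> 1 \<and> (d (ell \<beta>) \<noteq> 1 \<or> a (ell \<beta> + 1) < cap \<beta> (ell \<beta> + 1))"
    using assms(1) unfolding x restricted_ideal_code_def ideal_code_def by auto
  have "a' j \<le> cap \<beta> j" if "j \<in> {1..ell \<beta> + 1}" for j
    using code(1) that unfolding a'_def act_def by (cases j) auto
  moreover have "d' i \<le> delta \<beta> i + 1" if "i \<in> {1..ell \<beta>}" for i
    using code(2) that unfolding d'_def by auto
  moreover have "i < ell \<beta> \<and> a' (i + 1) = cap \<beta> (i + 1)" if "i \<in> {1..ell \<beta>}" "d' i = 1" for i
  proof -
    have "\<not> act i" "d i = 1" using that unfolding d'_def by (auto split: if_splits)
    then have "\<not> a (i + 1) < cap \<beta> (i + 1)" using that unfolding act_def by auto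
    then have a: "a (i + 1) = cap \<beta> (i + 1)" using code(1) that by (auto simp: not_less intro!: antisym)
    moreover have "i \<noteq> ell \<beta>" using a code(3) \<open>d i = 1\<close> that by auto
    ultimately show ?thesis using \<open>\<not> act i\<close> that unfolding a'_def by auto
  qed
  moreover have "1 < i \<and> a' i = cap \<beta> i \<and> 0 < d' (i - 1)"
    if "i \<in> {1..ell \<beta>}" "d' i = delta \<beta> i + 1" for i
  proof -
    have d: "d i = delta \<beta> i + 1" using that unfolding d'_def by (auto split: if_splits)
    then have "i \<noteq> 1" using code(3) that by auto
    then have i: "1 < i" using that by auto
    then have a: "a i = cap \<beta> i" "0 < d (i - 1)" using code(2) d that by auto
    \<comment> \<open>Since \<open>a i\<close> is at its cap, \<open>PH1\<close> had no room to move
      a unit from \<open>d (i - 1)\<close> to it; both values are unchanged.\<close>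
    then have "\<not> act (i - 1)" using i unfolding act_def by auto
    then show ?thesis using i a unfolding a'_def d'_def by auto
  qed
  ultimately show ?thesis unfolding PH1 PH1_code_def by auto
qed

lemma code_size_PH1: "code_size \<beta> (PH1 \<beta> x) = code_size \<beta> x"
proof -
  obtain a d where x: "x = (a, d)" by (cases x)
  obtain a' d' where PH1: "PH1 \<beta> x = (a', d')" by (cases "PH1 \<beta> x")
  have "a' 1 = a 1" "\<And>i. i \<in> {1..ell \<beta>} \<Longrightarrow> a' (Suc i) + d' i = a (Suc i) + d i"
    using PH1 unfolding x PH1_def by (auto simp: Let_def)
  \<comment> \<open>With the first term split off, \<open>a (Suc i)\<close> is paired with
    \<open>d i\<close>, and each such sum is preserved.\<close>
  moreover have "(\<Sum>j=1..ell \<beta> + 1. f j) = f 1 + (\<Sum>i=1..ell \<beta>. f (Suc i))" for f :: "nat \<Rightarrow> nat"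
    by (subst sum.atLeast_Suc_atMost) (auto simp: sum.atLeast_Suc_atMost_Suc_shift simp del: sum.cl_ivl_Suc)
  ultimately show ?thesis
    unfolding PH1 unfolding x code_size_def
    by (simp add: add.assoc flip: sum.distrib del: sum.cl_ivl_Suc)
qed

text \<open>The step acted at \<open>i\<close> exactly if afterwards \<open>d i\<close> is zero and
  \<open>a (i + 1)\<close> is positive: in the code of an ideal a positive \<open>a (i + 1)\<close>
  comes with a positive \<open>d i\<close>.\<close>

lemma PH1_inj:
  assumes "ideal_code \<beta> x" "ideal_code \<beta> x'" "same_code \<beta> (PH1 \<beta> x) (PH1 \<beta> x')"
  shows "same_code \<beta> x x'"
proof -
  have inv: "d i = (if d1 i = 0 \<and> 0 < a1 (i + 1) then 1 else d1 i) \<and>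
      a (i + 1) = (if d1 i = 0 \<and> 0 < a1 (i + 1) then a1 (i + 1) - 1 else a1 (i + 1))"
    if "ideal_code \<beta> (a, d)" "PH1 \<beta> (a, d) = (a1, d1)" "i \<in> {1..ell \<beta>}" for a d a1 d1 i
  proof -
    have "0 < a (i + 1) \<longrightarrow> 0 < d i"
      using that unfolding ideal_code_def by auto
    moreover have "a1 = (\<lambda>j. if j - 1 \<in> {1..ell \<beta>} \<and> d (j - 1) = 1 \<and> a (j - 1 + 1) < cap \<beta> (j - 1 + 1) then a j + 1 else a j)"
      "d1 = (\<lambda>i. if i \<in> {1..ell \<beta>} \<and> d i = 1 \<and> a (i + 1) < cap \<beta> (i + 1) then 0 else d i)"
      using that(2) unfolding PH1_def by (auto simp: Let_def)
    ultimately show ?thesis using that(3) by auto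
  qed
  have one: "a 1 = a1 1" if "PH1 \<beta> (a, d) = (a1, d1)" for a d a1 d1
    using that unfolding PH1_def by (auto simp: Let_def)
  obtain a d a' d' where x: "x = (a, d)" "x' = (a', d')" by (cases x, cases x')
  obtain a1 d1 a1' d1' where y: "PH1 \<beta> (a, d) = (a1, d1)" "PH1 \<beta> (a', d') = (a1', d1')"
    by (cases "PH1 \<beta> (a, d)", cases "PH1 \<beta> (a', d')")
  have eq: "\<forall>j\<in>{1..ell \<beta> + 1}. a1 j = a1' j" "\<forall>i\<in>{1..ell \<beta>}. d1 i = d1' i"
    using assms(3) unfolding x y same_code_def by auto
  have "d i = d' i \<and> a (i + 1) = a' (i + 1)" if "i \<in> {1..ell \<beta>}" for i
    using inv[OF assms(1)[unfolded x] y(1) that] inv[OF assms(2)[unfolded x] y(2) that] eq that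
    by (auto split: if_splits)
  moreover have "a 1 = a' 1" using one[OF y(1)] one[OF y(2)] eq by auto
  moreover have "a j = a' j" if "j \<in> {1..ell \<beta> + 1}" for j
  proof (cases "j = 1")
    case False
    then have "j - 1 \<in> {1..ell \<beta>}" using that by auto
    then show ?thesis using calculation(1)[of "j - 1"] that by auto
  qed (use calculation(2) in simp)
  ultimately show ?thesis unfolding x same_code_def by auto
qed

lemma PH2_phi_rule:
  assumes "PH1_code \<beta> (a, d)"
  obtains t e where "PH2 \<beta> (a, d) = (a, e)" "phi_rule (ell \<beta>) (\<lambda>i. a i < cap \<beta> i) d t e"
    "no_one_before_cut_on (ell \<beta>) (\<lambda>i. a i < cap \<beta> i) d"
proof -
  have gap: "no_one_before_cut_on (ell \<beta>) (\<lambda>i. a i < cap \<beta> i) d"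
    using assms unfolding PH1_code_def no_one_before_cut_on_def by auto
  then show thesis
    using concat_phi_factors_map(1)[OF gap] that unfolding PH2_def Let_def prod.case by blast
qed

text \<open>Units are added only at the start of a block, where \<open>d i\<close> is not full, so
  no entry grows too large. A one in the image is either a shifted one, whose left neighbour
  satisfied \<open>PH1_code\<close>, or a block entry that does not start a block; in both cases
  there is no cut before it. A full entry cannot have lost a unit, so its block continues to the
  right.\<close>

lemma PH2_code_PH2:
  assumes "PH1_code \<beta> x" "\<forall>i\<in>{1..ell \<beta>}. 0 < delta \<beta> i"
  shows "PH2_code \<beta> (PH2 \<beta> x)"
proof -
  obtain a d where x: "x = (a, d)" by (cases x)
  obtain t e where e: "PH2 \<beta> (a, d) = (a, e)"
    and rule: "phi_rule (ell \<beta>) (\<lambda>i. a i < cap \<beta> i) d t e"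
    and gap: "no_one_before_cut_on (ell \<beta>) (\<lambda>i. a i < cap \<beta> i) d"
    using PH2_phi_rule assms(1) x by blast
  note run = phi_rule_in_run[OF rule gap]
  note block = phi_rule_in_block[OF rule gap]
  have code: "\<forall>j\<in>{1..ell \<beta> + 1}. a j \<le> cap \<beta> j"
     "\<forall>i\<in>{1..ell \<beta>}. d i \<le> delta \<beta> i + 1 \<and>
        (d i = 1 \<longrightarrow> i < ell \<beta> \<and> a (i + 1) = cap \<beta> (i + 1)) \<and>
        (d i = delta \<beta> i + 1 \<longrightarrow> 1 < i \<and> a i = cap \<beta> i \<and> 0 < d (i - 1))"
    using assms(1) unfolding x PH1_code_def by auto
  have first: "d i \<le> delta \<beta> i"
    if i: "i \<in> {1..ell \<beta>}" "\<not> t i" "i = 1 \<or> a i < cap \<beta> i \<or> t (i - 1)" for i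
  proof (rule ccontr)
    assume "\<not> d i \<le> delta \<beta> i"
    then have "d i = delta \<beta> i + 1" using code(2)[rule_format, OF i(1)] by linarith
    then have *: "1 < i" "a i = cap \<beta> i" "0 < d (i - 1)"
      using code(2)[rule_format, OF i(1)] by auto
    \<comment> \<open>Only the alternative \<open>t (i - 1)\<close> is left. As \<open>i\<close>
      itself is not in a run, it would mean \<open>d (i - 1) = 0\<close>.\<close>
    have "i - 1 \<in> {1..ell \<beta>}" "t (i - 1)" using * i(1,3) by auto
    then show False
      using phi_rule_t[OF rule gap, of "i - 1"] i(2) * by auto
  qed
  have bound: "d i + of_bool (i = 1 \<or> a i < cap \<beta> i \<or> t (i - 1)) \<le> delta \<beta> i + 1"
    if i: "i \<in> {1..ell \<beta>}" "\<not> t i" for i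
  proof (cases "i = 1 \<or> a i < cap \<beta> i \<or> t (i - 1)")
    case True
    then show ?thesis using first[OF i True] by (simp only: of_bool_eq)
  next
    case False
    then show ?thesis
      using code(2)[rule_format, OF i(1)] by (simp only: of_bool_eq add_0_right)
  qed
  have "e i \<le> delta \<beta> i + 1" if i: "i \<in> {1..ell \<beta>}" for i
  proof (cases "t i")
    case True
    then show ?thesis using run[OF i] by auto
  next
    case False
    have "e i \<le> d i + of_bool (i = 1 \<or> a i < cap \<beta> i \<or> t (i - 1))"
      unfolding block(1)[OF i False] by (rule diff_le_self)
    also have "\<dots> \<le> delta \<beta> i + 1" using bound[OF i False] .
    finally show ?thesis .
  qed
  moreover have "1 < i \<and> a i = cap \<beta> i" if i: "i \<in> {1..ell \<beta>}" "e i = 1" for i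
  proof (cases "t i")
    case True
    then have "1 < i" "d (i - 1) = 1" 
      using run[OF i(1) True] i(2) by (metis of_bool_eq(1) zero_neq_one)+
    moreover have "i - 1 \<in> {1..ell \<beta>}" using calculation i(1) by auto
    ultimately show ?thesis using code(2)[rule_format, of "i - 1"] by auto
  next
    case False
    then have "i \<noteq> 1" "\<not> a i < cap \<beta> i"
      using phi_rule_block_bounds(2)[OF rule gap i(1) False] i(2) by (metis less_irrefl)+
    then show ?thesis using code(1)[rule_format, of i] i(1) by auto
  qed
  moreover have "i < ell \<beta> \<and> a (i + 1) = cap \<beta> (i + 1) \<and> 0 < e (i + 1)"
    if i: "i \<in> {1..ell \<beta>}" "e i = delta \<beta> i + 1" for i
  proof -
    have "of_bool P \<noteq> delta \<beta> i + 1" for P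
      using assms(2)[rule_format, OF i(1)] by (cases P) auto
    then have nt: "\<not> t i" using run[OF i(1)] i(2) by metis
    have "\<not> (a (i + 1) < cap \<beta> (i + 1) \<or> t (i + 1))"
    proof
      assume last: "a (i + 1) < cap \<beta> (i + 1) \<or> t (i + 1)"
      define N where "N = d i + of_bool (i = 1 \<or> a i < cap \<beta> i \<or> t (i - 1))"
      have "e i = N - 1"
        using block(1)[OF i(1) nt] last unfolding N_def by (simp only: of_bool_eq)
      moreover have "N \<le> delta \<beta> i + 1"
        using bound[OF i(1) nt] unfolding N_def .
      ultimately show False using i(2) by simp
    qed
    \<comment> \<open>The end of the sequence counts as a run position, which is why a full entry
      cannot be the last one.\<close>
    moreover have "t (ell \<beta> + 1)" using rule unfolding phi_rule_def by blast
    ultimately have "i < ell \<beta>" "a (i + 1) = cap \<beta> (i + 1)" "\<not> t (i + 1)"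
      using i(1) code(1)[rule_format, of "i + 1"] by (auto simp: le_less)
    then show ?thesis using phi_rule_block_bounds(1)[OF rule gap, of "i + 1"] by auto
  qed
  ultimately show ?thesis using code(1) unfolding x e PH2_code_def by auto
qed

lemma code_size_PH2:
  assumes "PH1_code \<beta> x"
  shows "code_size \<beta> (PH2 \<beta> x) = code_size \<beta> x"
proof -
  obtain a d where x: "x = (a, d)" by (cases x)
  have gap: "no_one_before_cut_on (ell \<beta>) (\<lambda>i. a i < cap \<beta> i) d"
    using assms unfolding x PH1_code_def no_one_before_cut_on_def by auto
  define es where "es = concat (map phi (factors (\<lambda>i. a i < cap \<beta> i) 1 (map d [1..<ell \<beta> + 1])))"
  have "no_one_before_cut (\<lambda>i. a i < cap \<beta> i) 1 (map d [1..<ell \<beta> + 1])"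
    using gap by (intro no_one_before_cut_map) (auto simp: no_one_before_cut_on_def)
  then have len: "length es = ell \<beta>"
    unfolding es_def by (simp add: concat_phi_factors length_phi_local del: upt_Suc)
  have "(\<Sum>i=1..ell \<beta>. es ! (i - 1)) = sum_list es"
    using len by (simp add: sum_list_sum_nth sum.shift_bounds_cl_Suc_ivl atLeast0LessThan
        sum.atLeast1_atMost_eq)
  also have "\<dots> = sum_list (map d [1..<ell \<beta> + 1])"
    unfolding es_def by (rule concat_phi_factors_map(2)[OF gap])
  also have "\<dots> = (\<Sum>i=1..ell \<beta>. d i)"
    by (simp add: interv_sum_list_conv_sum_set_nat atLeastLessThanSuc_atLeastAtMost del: upt_Suc)
  finally show ?thesis
    unfolding x PH2_def code_size_def es_def by (simp add: Let_def)
qed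

text \<open>The two codes agree in \<open>a\<close> after the step, hence before it, so both
  sequences were cut at the same places.\<close>

lemma PH2_inj:
  assumes "PH1_code \<beta> x" "PH1_code \<beta> x'" "same_code \<beta> (PH2 \<beta> x) (PH2 \<beta> x')"
  shows "same_code \<beta> x x'"
proof -
  obtain a d a' d' where x: "x = (a, d)" "x' = (a', d')" by (cases x, cases x')
  obtain t e where e: "PH2 \<beta> (a, d) = (a, e)"
    and rule: "phi_rule (ell \<beta>) (\<lambda>i. a i < cap \<beta> i) d t e"
    and gap: "no_one_before_cut_on (ell \<beta>) (\<lambda>i. a i < cap \<beta> i) d"
    using PH2_phi_rule assms(1) x by blast
  obtain t' e' where e': "PH2 \<beta> (a', d') = (a', e')"
    and rule': "phi_rule (ell \<beta>) (\<lambda>i. a' i < cap \<beta> i) d' t' e'"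
    and gap': "no_one_before_cut_on (ell \<beta>) (\<lambda>i. a' i < cap \<beta> i) d'"
    using PH2_phi_rule assms(2) x by blast
  have a: "\<forall>j\<in>{1..ell \<beta> + 1}. a j = a' j" and ee: "\<forall>i\<in>{1..ell \<beta>}. e i = e' i"
    using assms(3) unfolding x e e' same_code_def by auto
  have "d i = d' i" if "i \<in> {1..ell \<beta>}" for i
    using a ee that by (intro phi_rule_inj[OF rule gap rule' gap']) auto
  then show ?thesis using a unfolding x same_code_def by auto
qed

text \<open>\<open>PH3\<close> creates no full entry, since \<open>1 < delta \<beta> i + 1\<close>,
  and the last entry was not full before. The first entry was not \<open>1\<close> before; if it is
  now, \<open>PH3\<close> has just taken a unit from \<open>b 1\<close>, which is therefore below
  its cap.\<close>

lemma restricted_filter_code_PH3: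
  assumes "PH2_code \<beta> x" "\<forall>i\<in>{1..ell \<beta>}. 0 < delta \<beta> i"
  shows "restricted_filter_code \<beta> (PH3 \<beta> x)"
proof -
  obtain b e where x: "x = (b, e)" by (cases x)
  define act where "act i \<longleftrightarrow> i \<in> {1..ell \<beta>} \<and> e i = 0 \<and> b i > 0" for i
  define b' where "b' = (\<lambda>j. if act j then b j - 1 else b j)"
  define e' where "e' = (\<lambda>i. if act i then 1 else e i)"
  have PH3: "PH3 \<beta> x = (b', e')"
    by (simp add: x PH3_def b'_def e'_def act_def Let_def)
  have code: "\<forall>j\<in>{1..ell \<beta> + 1}. b j \<le> cap \<beta> j"
     "\<forall>i\<in>{1..ell \<beta>}. e i \<le> delta \<beta> i + 1 \<and>
        (e i = 1 \<longrightarrow> 1 < i \<and> b i = cap \<beta> i) \<and>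
        (e i = delta \<beta> i + 1 \<longrightarrow> i < ell \<beta> \<and> b (i + 1) = cap \<beta> (i + 1) \<and> 0 < e (i + 1))"
    using assms(1) unfolding x PH2_code_def by auto
  have "b' j \<le> cap \<beta> j" if "j \<in> {1..ell \<beta> + 1}" for j
    using code(1)[rule_format, OF that] unfolding b'_def by auto
  moreover have "e' i \<le> delta \<beta> i + 1 \<and> (0 < b' i \<longrightarrow> 0 < e' i)" if "i \<in> {1..ell \<beta>}" for i
    using code(2) that unfolding b'_def e'_def act_def by auto
  moreover have full: "i < ell \<beta> \<and> b' (i + 1) = cap \<beta> (i + 1) \<and> 0 < e' (i + 1)"
    if "i \<in> {1..ell \<beta>}" "e' i = delta \<beta> i + 1" for i
  proof -
    have "e i = delta \<beta> i + 1"
      using that assms(2)[rule_format, OF that(1)] unfolding e'_def by (auto split: if_splits)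
    then have "i < ell \<beta> \<and> b (i + 1) = cap \<beta> (i + 1) \<and> 0 < e (i + 1)"
      using code(2) that(1) by blast
    then show ?thesis unfolding b'_def e'_def act_def by auto
  qed
  ultimately have "filter_code \<beta> (b', e')" unfolding filter_code_def by auto
  moreover have "e' (ell \<beta>) \<le> delta \<beta> (ell \<beta>)" if "1 \<le> ell \<beta>"
  proof -
    have "e' (ell \<beta>) \<le> delta \<beta> (ell \<beta>) + 1" "e' (ell \<beta>) \<noteq> delta \<beta> (ell \<beta>) + 1"
      using full[of "ell \<beta>"] that \<open>filter_code \<beta> (b', e')\<close> unfolding filter_code_def by auto
    then show ?thesis by linarith
  qed
  moreover have "b' 1 < cap \<beta> 1" if "1 \<le> ell \<beta>" "e' 1 = 1"
  proof -
    have "1 \<in> {1..ell \<beta>}" using that(1) by simp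
    then have "e 1 \<noteq> 1" using code(2) by blast
    then have "act 1" using that(2) unfolding e'_def by presburger
    then show ?thesis using code(1)[rule_format, of 1] unfolding b'_def by (auto simp: act_def)
  qed
  ultimately show ?thesis unfolding PH3 restricted_filter_code_def by auto
qed

lemma code_size_PH3: "code_size \<beta> (PH3 \<beta> x) = code_size \<beta> x"
proof -
  obtain b e where x: "x = (b, e)" by (cases x)
  obtain b' e' where PH3: "PH3 \<beta> x = (b', e')" by (cases "PH3 \<beta> x")
  have "b' (Suc (ell \<beta>)) = b (Suc (ell \<beta>))" "\<And>i. i \<in> {1..ell \<beta>} \<Longrightarrow> b' i + e' i = b i + e i"
    using PH3 unfolding x PH3_def by (auto simp: Let_def)
  then have "b' (Suc (ell \<beta>)) + (\<Sum>i=1..ell \<beta>. b' i + e' i)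
      = b (Suc (ell \<beta>)) + (\<Sum>i=1..ell \<beta>. b i + e i)"
    by (metis (no_types, lifting) sum.cong)
  then show ?thesis
    unfolding PH3 unfolding x code_size_def by (simp add: sum.distrib)
qed

text \<open>A one made by \<open>PH3\<close> stands beside a \<open>b i\<close> that has just
  dropped below its cap, whereas a one present earlier has \<open>b i\<close> at its cap.\<close>

lemma PH3_inj:
  assumes "PH2_code \<beta> x" "PH2_code \<beta> x'" "same_code \<beta> (PH3 \<beta> x) (PH3 \<beta> x')"
  shows "same_code \<beta> x x'"
proof -
  have inv: "e i = (if e1 i = 1 \<and> b1 i < cap \<beta> i then 0 else e1 i) \<and>
      b i = (if e1 i = 1 \<and> b1 i < cap \<beta> i then b1 i + 1 else b1 i)"
    if "PH2_code \<beta> (b, e)" "PH3 \<beta> (b, e) = (b1, e1)" "i \<in> {1..ell \<beta>}" for b e b1 e1 i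
  proof -
    have "e i = 1 \<longrightarrow> b i = cap \<beta> i" "b i \<le> cap \<beta> i"
      using that unfolding PH2_code_def by auto
    moreover have "b1 = (\<lambda>i. if i \<in> {1..ell \<beta>} \<and> e i = 0 \<and> b i > 0 then b i - 1 else b i)"
      "e1 = (\<lambda>i. if i \<in> {1..ell \<beta>} \<and> e i = 0 \<and> b i > 0 then 1 else e i)"
      using that(2) unfolding PH3_def by (auto simp: Let_def)
    ultimately show ?thesis using that(3) by auto
  qed
  have final: "b (ell \<beta> + 1) = b1 (ell \<beta> + 1)" if "PH3 \<beta> (b, e) = (b1, e1)" for b e b1 e1
    using that unfolding PH3_def by (auto simp: Let_def)
  obtain b e b' e' where x: "x = (b, e)" "x' = (b', e')" by (cases x, cases x')
  obtain b1 e1 b1' e1' where y: "PH3 \<beta> (b, e) = (b1, e1)" "PH3 \<beta> (b', e') = (b1', e1')"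
    by (cases "PH3 \<beta> (b, e)", cases "PH3 \<beta> (b', e')")
  have eq: "\<forall>j\<in>{1..ell \<beta> + 1}. b1 j = b1' j" "\<forall>i\<in>{1..ell \<beta>}. e1 i = e1' i"
    using assms(3) unfolding x y same_code_def by auto
  have "e i = e' i \<and> b i = b' i" if "i \<in> {1..ell \<beta>}" for i
    using inv[OF assms(1)[unfolded x] y(1) that] inv[OF assms(2)[unfolded x] y(2) that] eq that
    by (auto split: if_splits)
  moreover have "b (ell \<beta> + 1) = b' (ell \<beta> + 1)" using final[OF y(1)] final[OF y(2)] eq by auto
  moreover have "b j = b' j" if "j \<in> {1..ell \<beta> + 1}" for j
    using calculation that by (cases "j = ell \<beta> + 1") auto
  ultimately show ?thesis unfolding x same_code_def by auto
qed

section \<open>Filters and ideals of the fence\<close>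

text \<open>Two such subsets are nested, hence equal if they have the same size. The relation is a
  parameter because ascending segments use the order of the numbering and descending ones its
  converse.\<close>

lemma closed_subsets_of_chain_eq:
  assumes "finite S" "X \<subseteq> S" "Y \<subseteq> S" "card X = card Y"
    and "\<And>x y. x \<in> S \<Longrightarrow> y \<in> S \<Longrightarrow> R x y \<or> R y x"
    and "\<And>x y. x \<in> X \<Longrightarrow> y \<in> S \<Longrightarrow> R x y \<Longrightarrow> y \<in> X"
    and "\<And>x y. x \<in> Y \<Longrightarrow> y \<in> S \<Longrightarrow> R x y \<Longrightarrow> y \<in> Y"
  shows "X = Y"
proof -
  have "X \<subseteq> Y \<or> Y \<subseteq> X" using assms by blast
  then show ?thesis
    using assms(1-4) by (metis card_subset_eq finite_subset)
qed

lemma ex_down_closed_subset: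
  fixes S :: "'a :: linorder set"
  assumes "finite S" "n \<le> card S"
  shows "\<exists>X\<subseteq>S. card X = n \<and> (\<forall>x\<in>X. \<forall>y\<in>S. y \<le> x \<longrightarrow> y \<in> X)"
  using assms(2)
proof (induction n)
  case 0
  then show ?case by (intro exI[of _ "{}"]) auto
next
  case (Suc n)
  then obtain X where X: "X \<subseteq> S" "card X = n" "\<forall>x\<in>X. \<forall>y\<in>S. y \<le> x \<longrightarrow> y \<in> X" by auto
  define m where "m = Min (S - X)"
  have "S - X \<noteq> {}" using X Suc.prems by (metis Diff_eq_empty_iff Suc_n_not_le_n subset_antisym)
  then have m: "m \<in> S - X" "\<And>y. y \<in> S - X \<Longrightarrow> m \<le> y"
    unfolding m_def using assms(1) by (auto intro: Min_in simp del: Diff_iff)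
  have "card (insert m X) = Suc n"
    using m(1) X assms(1) by (simp add: finite_subset)
  moreover have "y \<in> insert m X" if "x \<in> insert m X" "y \<in> S" "y \<le> x" for x y
    using that X(3) m by fastforce
  ultimately show ?case using X m(1) by (intro exI[of _ "insert m X"]) blast
qed

lemma ex_up_closed_subset:
  fixes S :: "'a :: linorder set"
  assumes "finite S" "n \<le> card S"
  shows "\<exists>X\<subseteq>S. card X = n \<and> (\<forall>x\<in>X. \<forall>y\<in>S. x \<le> y \<longrightarrow> y \<in> X)"
proof -
  obtain X where X: "X \<subseteq> S" "card X = card S - n" "\<forall>x\<in>X. \<forall>y\<in>S. y \<le> x \<longrightarrow> y \<in> X"
    using ex_down_closed_subset[OF assms(1), of "card S - n"] by auto
  then have "card (S - X) = n"
    using assms by (simp add: card_Diff_subset finite_subset)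
  then show ?thesis using X by (intro exI[of _ "S - X"]) blast
qed

lemma finite_fence: "finite (fence \<beta>)"
  by (simp add: fence_def segment_def)

lemma finite_desc: "finite (desc \<beta> i)"
  by (simp add: desc_def segment_def)

lemma finite_asc_unshared: "finite (asc_unshared \<beta> j)"
  by (simp add: asc_unshared_def asc_def segment_def)

lemma junction_mem_segment:
  "junction \<beta> k \<in> segment \<beta> k" "1 \<le> k \<Longrightarrow> junction \<beta> (k - 1) \<in> segment \<beta> k"
  using junction_mono[of "k - 1" k \<beta>] by (auto simp: segment_def)

lemma segment_subset_fence: "k \<in> {1..length \<beta>} \<Longrightarrow> segment \<beta> k \<subseteq> fence \<beta>"
  by (auto simp: fence_def)

lemma asc_unshared_subset_asc: "asc_unshared \<beta> j \<subseteq> asc \<beta> j"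
  by (auto simp: asc_unshared_def)

lemma finite_restricted_ideals: "finite (restricted_ideals \<beta> k)"
  by (rule finite_subset[of _ "Pow (fence \<beta>)"])
    (auto simp: restricted_ideals_def restricted_ideal_def fence_ideals_def finite_fence)

lemma finite_restricted_filters: "finite (restricted_filters \<beta> k)"
  by (rule finite_subset[of _ "Pow (fence \<beta>)"])
    (auto simp: restricted_filters_def restricted_filter_def fence_filters_def finite_fence)

section \<open>Decomposition of the fence and codes of filters\<close>

context
  fixes \<beta> :: "nat list"
  assumes odd_length: "odd (length \<beta>)"
begin

lemma length_eq: "length \<beta> = 2 * ell \<beta> + 1"
  using odd_length unfolding ell_def by presburger

lemma desc_subset_fence: "i \<in> {1..ell \<beta>} \<Longrightarrow> desc \<beta> i \<subseteq> fence \<beta>"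
  using length_eq segment_subset_fence[of "2 * i"] by (auto simp: desc_def)

lemma asc_subset_fence: "j \<in> {1..ell \<beta> + 1} \<Longrightarrow> asc \<beta> j \<subseteq> fence \<beta>"
  unfolding asc_def using length_eq by (intro segment_subset_fence) auto

lemma asc_unshared_subset_fence: "j \<in> {1..ell \<beta> + 1} \<Longrightarrow> asc_unshared \<beta> j \<subseteq> fence \<beta>"
  using asc_subset_fence asc_unshared_subset_asc by blast

lemma card_desc: "i \<in> {1..ell \<beta>} \<Longrightarrow> card (desc \<beta> i) = delta \<beta> i + 1"
  using length_eq by (auto simp: desc_def delta_def card_segment)

context
  assumes pos: "\<forall>x\<in>set \<beta>. 0 < x"
begin

lemma delta_pos: "\<forall>i\<in>{1..ell \<beta>}. 0 < delta \<beta> i"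
  using pos length_eq by (auto simp: delta_def)

lemma asc_shared_cases:
  assumes "x \<in> asc \<beta> j" "j \<in> {1..ell \<beta> + 1}" "x \<notin> asc_unshared \<beta> j"
  shows "j \<le> ell \<beta> \<and> x = junction \<beta> (2 * j - 1) \<or> 1 < j \<and> x = junction \<beta> (2 * (j - 1))"
proof -
  have x: "x \<in> segment \<beta> (2 * j - 1)" using assms by (simp add: asc_def)
  have "shared \<beta> x" using assms by (simp add: asc_unshared_def)
  then obtain k where k: "k \<in> {1..length \<beta>}" "k \<noteq> 2 * j - 1" "x \<in> segment \<beta> k"
    unfolding shared_def by metis
  have j: "1 \<le> 2 * j - 1" "2 * j - 1 \<le> length \<beta>" using assms(2) length_eq by auto
  consider "k = Suc (2 * j - 1)" | "2 * j - 1 = Suc k" | "Suc (2 * j - 1) < k" | "Suc k < 2 * j - 1"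
    using k(2) by linarith
  then show ?thesis
  proof cases
    case 1
    then have "x = junction \<beta> (2 * j - 1)"
      using segment_Int_Suc[OF j(1), of \<beta>] k x by auto
    moreover have "j \<le> ell \<beta>" using 1 k(1) length_eq by auto
    ultimately show ?thesis by blast
  next
    case 2
    then have "x = junction \<beta> k" "k = 2 * (j - 1)"
      using segment_Int_Suc[of k \<beta>] k x by auto
    then show ?thesis using k(1) by auto
  next
    case 3
    then show ?thesis using segment_disjoint[OF pos j(1) 3] k x by auto
  next
    case 4
    then show ?thesis using segment_disjoint[OF pos _ 4 j(2)] k x by auto
  qed
qed

text \<open>Every shared element of an ascending segment is an end of a descending one. With the
  disjointness lemmas that follow this is a partition, so a code adds up to the number of
  elements.\<close>

lemma fence_eq_Un:
  "fence \<beta> = (\<Union>j\<in>{1..ell \<beta> + 1}. asc_unshared \<beta> j) \<union> (\<Union>i\<in>{1..ell \<beta>}. desc \<beta> i)"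
proof
  show "(\<Union>j\<in>{1..ell \<beta> + 1}. asc_unshared \<beta> j) \<union> (\<Union>i\<in>{1..ell \<beta>}. desc \<beta> i) \<subseteq> fence \<beta>"
    using desc_subset_fence asc_subset_fence asc_unshared_subset_asc by blast
next
  show "fence \<beta> \<subseteq> (\<Union>j\<in>{1..ell \<beta> + 1}. asc_unshared \<beta> j) \<union> (\<Union>i\<in>{1..ell \<beta>}. desc \<beta> i)"
  proof
    fix x assume "x \<in> fence \<beta>"
    then obtain k where k: "k \<in> {1..length \<beta>}" "x \<in> segment \<beta> k" by (auto simp: fence_def)
    show "x \<in> (\<Union>j\<in>{1..ell \<beta> + 1}. asc_unshared \<beta> j) \<union> (\<Union>i\<in>{1..ell \<beta>}. desc \<beta> i)"
    proof (cases "even k")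
      case True
      then obtain i where i: "k = 2 * i" by blast
      then have "i \<in> {1..ell \<beta>}" "x \<in> desc \<beta> i" using k length_eq by (auto simp: desc_def)
      then show ?thesis by blast
    next
      case False
      then obtain j' where "k = 2 * j' + 1" by (rule oddE)
      then obtain j where j: "k = 2 * j - 1" "1 \<le> j" by (intro that[of "j' + 1"]) auto
      then have j': "j \<in> {1..ell \<beta> + 1}" "x \<in> asc \<beta> j" using k length_eq by (auto simp: asc_def)
      show ?thesis
      proof (cases "x \<in> asc_unshared \<beta> j")
        case True
        then show ?thesis using j' by blast
      next
        case False
        then consider "j \<le> ell \<beta>" "x = junction \<beta> (2 * j - 1)" | "1 < j" "x = junction \<beta> (2 * (j - 1))"
          using asc_shared_cases[OF j'(2,1)] by blast
        then show ?thesis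
        proof cases
          case 1
          then have "x \<in> desc \<beta> j"
            using junction_mem_segment(2)[of "2 * j" \<beta>] j by (simp add: desc_def)
          then show ?thesis using 1 j by auto
        next
          case 2
          then have "x \<in> desc \<beta> (j - 1)"
            using junction_mem_segment(1)[of \<beta> "2 * (j - 1)"] by (simp add: desc_def)
          moreover have "j - 1 \<in> {1..ell \<beta>}" using 2 j' by auto
          ultimately show ?thesis by blast
        qed
      qed
    qed
  qed
qed

lemma asc_unshared_Int_desc:
  assumes "j \<in> {1..ell \<beta> + 1}" "i \<in> {1..ell \<beta>}"
  shows "asc_unshared \<beta> j \<inter> desc \<beta> i = {}"
proof -
  have "2 * j - 1 \<noteq> 2 * i" "2 * j - 1 \<in> {1..length \<beta>}" "2 * i \<in> {1..length \<beta>}"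
    using assms length_eq by (auto, presburger)
  then show ?thesis unfolding asc_unshared_def asc_def desc_def shared_def by blast
qed

lemma asc_unshared_disjoint:
  assumes "j \<in> {1..ell \<beta> + 1}" "j' \<in> {1..ell \<beta> + 1}" "j \<noteq> j'"
  shows "asc_unshared \<beta> j \<inter> asc_unshared \<beta> j' = {}"
proof -
  have "2 * j - 1 \<noteq> 2 * j' - 1" "2 * j - 1 \<in> {1..length \<beta>}" "2 * j' - 1 \<in> {1..length \<beta>}"
    using assms length_eq by auto
  then show ?thesis unfolding asc_unshared_def asc_def shared_def by blast
qed

lemma desc_disjoint:
  assumes "i \<in> {1..ell \<beta>}" "i' \<in> {1..ell \<beta>}" "i \<noteq> i'"
  shows "desc \<beta> i \<inter> desc \<beta> i' = {}"
proof -
  have "desc \<beta> i \<inter> desc \<beta> i' = {}" if "i \<in> {1..ell \<beta>}" "i' \<in> {1..ell \<beta>}" "i < i'" for i i'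
    unfolding desc_def using that length_eq by (intro segment_disjoint[OF pos]) auto
  then show ?thesis using assms by (metis Int_commute linorder_neqE_nat)
qed

lemma subset_fence_eq_Un:
  "X \<subseteq> fence \<beta> \<Longrightarrow> X = (\<Union>j\<in>{1..ell \<beta> + 1}. X \<inter> asc_unshared \<beta> j) \<union> (\<Union>i\<in>{1..ell \<beta>}. X \<inter> desc \<beta> i)"
  unfolding fence_eq_Un by blast

lemma card_eq_code_size:
  assumes "X \<subseteq> fence \<beta>"
  shows "card X = code_size \<beta> (acode \<beta> X, dcode \<beta> X)"
proof -
  let ?A = "\<Union>j\<in>{1..ell \<beta> + 1}. X \<inter> asc_unshared \<beta> j" and ?D = "\<Union>i\<in>{1..ell \<beta>}. X \<inter> desc \<beta> i"
  have "X = ?A \<union> ?D" using assms by (rule subset_fence_eq_Un)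
  moreover have "card (?A \<union> ?D) = card ?A + card ?D"
    using asc_unshared_Int_desc
    by (intro card_Un_disjoint) (fastforce simp: finite_desc finite_asc_unshared)+
  moreover have "card ?A = (\<Sum>j=1..ell \<beta> + 1. acode \<beta> X j)"
    unfolding acode_def using asc_unshared_disjoint finite_asc_unshared
    by (intro card_UN_disjoint) blast+
  moreover have "card ?D = (\<Sum>i=1..ell \<beta>. dcode \<beta> X i)"
    unfolding dcode_def using desc_disjoint finite_desc
    by (intro card_UN_disjoint) blast+
  ultimately show ?thesis unfolding code_size_def prod.case by metis
qed

lemma fence_le_desc:
  "i \<in> {1..ell \<beta>} \<Longrightarrow> x \<in> desc \<beta> i \<Longrightarrow> y \<in> desc \<beta> i \<Longrightarrow> y \<le> x \<Longrightarrow> fence_le \<beta> x y"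
  unfolding fence_le_def desc_def using length_eq by (intro bexI[of _ "2 * i"]) auto

lemma fence_le_asc:
  "j \<in> {1..ell \<beta> + 1} \<Longrightarrow> x \<in> asc \<beta> j \<Longrightarrow> y \<in> asc \<beta> j \<Longrightarrow> x \<le> y \<Longrightarrow> fence_le \<beta> x y"
  unfolding fence_le_def asc_def using length_eq by (intro bexI[of _ "2 * j - 1"]) auto

lemma fence_leE:
  assumes "fence_le \<beta> x y"
  obtains i where "i \<in> {1..ell \<beta>}" "x \<in> desc \<beta> i" "y \<in> desc \<beta> i" "y \<le> x"
    | j where "j \<in> {1..ell \<beta> + 1}" "x \<in> asc \<beta> j" "y \<in> asc \<beta> j" "x \<le> y"
proof -
  obtain k where k: "k \<in> {1..length \<beta>}" "x \<in> segment \<beta> k" "y \<in> segment \<beta> k"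
    "if odd k then x \<le> y else y \<le> x"
    using assms unfolding fence_le_def by blast
  show thesis
  proof (cases "even k")
    case True
    then obtain i where "k = 2 * i" by blast
    then show thesis using k length_eq that(1)[of i] by (auto simp: desc_def)
  next
    case False
    then obtain j where "k = 2 * j + 1" by (rule oddE)
    then show thesis using k length_eq that(2)[of "j + 1"] by (auto simp: asc_def)
  qed
qed

lemma junction_mem:
  "i \<in> {1..ell \<beta>} \<Longrightarrow> junction \<beta> (2 * i - 1) \<in> desc \<beta> i"
  "i \<in> {1..ell \<beta>} \<Longrightarrow> junction \<beta> (2 * i) \<in> desc \<beta> i"
  "j \<in> {1..ell \<beta> + 1} \<Longrightarrow> junction \<beta> (2 * j - 1) \<in> asc \<beta> j"
  "1 \<le> i \<Longrightarrow> junction \<beta> (2 * i) \<in> asc \<beta> (i + 1)"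
  using junction_mem_segment(1)[of \<beta>] junction_mem_segment(2)[of "2 * i + 1" \<beta>]
    junction_mem_segment(2)[of "2 * i" \<beta>]
  by (auto simp: asc_def desc_def)

lemma junction_bounds:
  "x \<in> desc \<beta> i \<Longrightarrow> junction \<beta> (2 * i - 1) \<le> x" "x \<in> desc \<beta> i \<Longrightarrow> x \<le> junction \<beta> (2 * i)"
  "x \<in> asc \<beta> j \<Longrightarrow> x \<le> junction \<beta> (2 * j - 1)" "x \<in> asc \<beta> (i + 1) \<Longrightarrow> junction \<beta> (2 * i) \<le> x"
  by (auto simp: asc_def desc_def segment_def)

lemma filter_code_of_filter:
  assumes "U \<in> fence_filters \<beta>"
  shows "filter_code \<beta> (acode \<beta> U, dcode \<beta> U)"
proof -
  have up: "y \<in> U" if "x \<in> U" "y \<in> fence \<beta>" "fence_le \<beta> x y" for x y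
    using assms that unfolding fence_filters_def by blast
  have "acode \<beta> U j \<le> cap \<beta> j" if "j \<in> {1..ell \<beta> + 1}" for j
    unfolding acode_def alpha_def by (simp add: card_mono finite_asc_unshared)
  moreover have "dcode \<beta> U i \<le> delta \<beta> i + 1" if "i \<in> {1..ell \<beta>}" for i
    unfolding dcode_def card_desc[OF that, symmetric] by (simp add: card_mono finite_desc)
  moreover have "0 < dcode \<beta> U i" if i: "i \<in> {1..ell \<beta>}" "0 < acode \<beta> U i" for i
  proof -
    obtain x where x: "x \<in> U" "x \<in> asc_unshared \<beta> i"
      using i(2) unfolding acode_def by (auto simp: card_gt_0_iff)
    then have "x \<in> asc \<beta> i" using asc_unshared_subset_asc by blast
    then have "fence_le \<beta> x (junction \<beta> (2 * i - 1))"
      using i(1) junction_bounds(3) junction_mem(3)[of i] by (intro fence_le_asc[of i]) auto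
    then have "junction \<beta> (2 * i - 1) \<in> U \<inter> desc \<beta> i"
      using up[OF x(1)] junction_mem(1)[OF i(1)] desc_subset_fence[OF i(1)] by blast
    then show ?thesis unfolding dcode_def by (auto simp: card_gt_0_iff finite_desc)
  qed
  moreover have "acode \<beta> U (i + 1) = cap \<beta> (i + 1) \<and> (i < ell \<beta> \<longrightarrow> 0 < dcode \<beta> U (i + 1))"
    if i: "i \<in> {1..ell \<beta>}" "dcode \<beta> U i = delta \<beta> i + 1" for i
  proof -
    have "U \<inter> desc \<beta> i = desc \<beta> i"
      using i card_desc finite_desc unfolding dcode_def by (intro card_subset_eq) auto
    then have J: "junction \<beta> (2 * i) \<in> U" using junction_mem(2)[OF i(1)] by blast
    have "asc \<beta> (i + 1) \<subseteq> U"
    proof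
      fix x assume x: "x \<in> asc \<beta> (i + 1)"
      then have "fence_le \<beta> (junction \<beta> (2 * i)) x"
        using i(1) junction_bounds(4) junction_mem(4)[of i] by (intro fence_le_asc[of "i + 1"]) auto
      moreover have "x \<in> fence \<beta>" using asc_subset_fence[of "i + 1"] x i(1) by auto
      ultimately show "x \<in> U" using up J by blast
    qed
    moreover from this have "U \<inter> asc_unshared \<beta> (i + 1) = asc_unshared \<beta> (i + 1)"
      using asc_unshared_subset_asc by blast
    moreover have "0 < dcode \<beta> U (i + 1)" if "i < ell \<beta>"
    proof -
      have "junction \<beta> (2 * (i + 1) - 1) \<in> U \<inter> desc \<beta> (i + 1)"
        using junction_mem(1)[of "i + 1"] junction_mem(3)[of "i + 1"] that calculation(1) by auto
      then show ?thesis unfolding dcode_def by (auto simp: card_gt_0_iff finite_desc)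
    qed
    ultimately show ?thesis by (simp add: acode_def alpha_def)
  qed
  ultimately show ?thesis unfolding filter_code_def by auto
qed

lemma filter_eqI:
  assumes "U \<in> fence_filters \<beta>" "V \<in> fence_filters \<beta>"
    and "same_code \<beta> (acode \<beta> U, dcode \<beta> U) (acode \<beta> V, dcode \<beta> V)"
  shows "U = V"
proof -
  have up: "y \<in> W" if "W \<in> {U, V}" "x \<in> W" "y \<in> fence \<beta>" "fence_le \<beta> x y" for x y W
    using assms(1,2) that unfolding fence_filters_def by blast
  have "U \<inter> asc_unshared \<beta> j = V \<inter> asc_unshared \<beta> j" if j: "j \<in> {1..ell \<beta> + 1}" for j
  proof -
    have "card (U \<inter> asc_unshared \<beta> j) = card (V \<inter> asc_unshared \<beta> j)"
      using assms(3) j unfolding same_code_def acode_def by auto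
    moreover have "y \<in> W \<inter> asc_unshared \<beta> j"
      if "W \<in> {U, V}" "x \<in> W \<inter> asc_unshared \<beta> j" "y \<in> asc_unshared \<beta> j" "x \<le> y" for W x y
      using up[OF that(1), of x y] fence_le_asc[OF j, of x y] that asc_unshared_subset_asc[of \<beta> j]
        asc_subset_fence[OF j] by blast
    ultimately show ?thesis
      by (intro closed_subsets_of_chain_eq[OF finite_asc_unshared, where R = "(\<le>)"]) auto
  qed
  moreover have "U \<inter> desc \<beta> i = V \<inter> desc \<beta> i" if i: "i \<in> {1..ell \<beta>}" for i
  proof -
    have "card (U \<inter> desc \<beta> i) = card (V \<inter> desc \<beta> i)"
      using assms(3) i unfolding same_code_def dcode_def by auto
    moreover have "y \<in> W \<inter> desc \<beta> i"
      if "W \<in> {U, V}" "x \<in> W \<inter> desc \<beta> i" "y \<in> desc \<beta> i" "y \<le> x" for W x y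
      using up[OF that(1), of x y] fence_le_desc[OF i, of x y] that desc_subset_fence[OF i] by blast
    ultimately show ?thesis
      by (intro closed_subsets_of_chain_eq[OF finite_desc, where R = "(\<ge>)"]) auto
  qed
  ultimately have "(\<Union>j\<in>{1..ell \<beta> + 1}. U \<inter> asc_unshared \<beta> j) \<union> (\<Union>i\<in>{1..ell \<beta>}. U \<inter> desc \<beta> i)
      = (\<Union>j\<in>{1..ell \<beta> + 1}. V \<inter> asc_unshared \<beta> j) \<union> (\<Union>i\<in>{1..ell \<beta>}. V \<inter> desc \<beta> i)"
    by simp
  moreover have "U \<subseteq> fence \<beta>" "V \<subseteq> fence \<beta>" using assms unfolding fence_filters_def by auto
  ultimately show ?thesis using subset_fence_eq_Un by metis
qed

text \<open>The filter takes the top \<open>b j\<close> unshared elements of each ascending segment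
  and the top \<open>e i\<close> elements of each descending one. Upward closure can then fail only
  at the junctions, where the conditions on the code take over.\<close>

lemma ex_filter_with_code:
  assumes "filter_code \<beta> (b, e)"
  shows "\<exists>U\<in>fence_filters \<beta>. encodes \<beta> U (b, e)"
proof -
  have code: "\<forall>j\<in>{1..ell \<beta> + 1}. b j \<le> cap \<beta> j"
     "\<forall>i\<in>{1..ell \<beta>}. e i \<le> delta \<beta> i + 1 \<and> (0 < b i \<longrightarrow> 0 < e i) \<and>
        (e i = delta \<beta> i + 1 \<longrightarrow> b (i + 1) = cap \<beta> (i + 1) \<and> (i < ell \<beta> \<longrightarrow> 0 < e (i + 1)))"
    using assms unfolding filter_code_def by auto
  have "\<exists>X\<subseteq>asc_unshared \<beta> j. card X = b j \<and> (\<forall>x\<in>X. \<forall>y\<in>asc_unshared \<beta> j. x \<le> y \<longrightarrow> y \<in> X)"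
    if "j \<in> {1..ell \<beta> + 1}" for j
    using code(1) that by (intro ex_up_closed_subset finite_asc_unshared) (auto simp: alpha_def)
  then obtain X where X: "\<And>j. j \<in> {1..ell \<beta> + 1} \<Longrightarrow> X j \<subseteq> asc_unshared \<beta> j \<and> card (X j) = b j \<and>
      (\<forall>x\<in>X j. \<forall>y\<in>asc_unshared \<beta> j. x \<le> y \<longrightarrow> y \<in> X j)"
    by metis
  \<comment> \<open>On a descending segment the upper elements are those with the smallest
    numbers.\<close>
  have "\<exists>Y\<subseteq>desc \<beta> i. card Y = e i \<and> (\<forall>x\<in>Y. \<forall>y\<in>desc \<beta> i. y \<le> x \<longrightarrow> y \<in> Y)"
    if "i \<in> {1..ell \<beta>}" for i
    using code(2) that card_desc[OF that] by (intro ex_down_closed_subset finite_desc) auto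
  then obtain Y where Y: "\<And>i. i \<in> {1..ell \<beta>} \<Longrightarrow> Y i \<subseteq> desc \<beta> i \<and> card (Y i) = e i \<and>
      (\<forall>x\<in>Y i. \<forall>y\<in>desc \<beta> i. y \<le> x \<longrightarrow> y \<in> Y i)"
    by metis
  define U where "U = (\<Union>j\<in>{1..ell \<beta> + 1}. X j) \<union> (\<Union>i\<in>{1..ell \<beta>}. Y i)"
  have UX: "U \<inter> asc_unshared \<beta> j = X j" if "j \<in> {1..ell \<beta> + 1}" for j
    using that X Y asc_unshared_disjoint[OF that] asc_unshared_Int_desc[OF that]
    unfolding U_def by blast
  have UY: "U \<inter> desc \<beta> i = Y i" if "i \<in> {1..ell \<beta>}" for i
    using that X Y desc_disjoint[OF that] asc_unshared_Int_desc[OF _ that]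
    unfolding U_def by blast
  have enc: "encodes \<beta> U (b, e)"
    using X Y UX UY unfolding encodes_def acode_def dcode_def by auto
  have top: "junction \<beta> (2 * i - 1) \<in> U" if i: "i \<in> {1..ell \<beta>}" "0 < e i" for i
  proof -
    obtain x where "x \<in> Y i" using Y[OF i(1)] i(2) by (metis card_gt_0_iff ex_in_conv)
    then have "junction \<beta> (2 * i - 1) \<in> Y i"
      using Y[OF i(1)] junction_mem(1)[OF i(1)] junction_bounds(1)[of x i] by blast
    then show ?thesis using i(1) unfolding U_def by blast
  qed
  have "y \<in> U" if x: "x \<in> U" and le: "fence_le \<beta> x y" for x y
    using le
  proof (cases rule: fence_leE)
    case (1 i)
    then have "x \<in> Y i" using x UY by blast
    then have "y \<in> Y i" using Y[OF 1(1)] 1 by blast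
    then show ?thesis using 1 unfolding U_def by blast
  next
    case (2 j)
    \<comment> \<open>An element of \<open>A_j\<close> strictly above \<open>x\<close> is unshared
      or the upper end, since the lower end is not above \<open>x\<close>. The upper end belongs to
      \<open>U\<close> as soon as \<open>0 < e j\<close>.\<close>
    have y: "y \<in> U" if all: "y \<in> asc_unshared \<beta> j \<Longrightarrow> y \<in> X j" "x < y \<Longrightarrow> j \<le> ell \<beta> \<Longrightarrow> 0 < e j"
    proof (cases "x = y \<or> y \<in> asc_unshared \<beta> j")
      case True
      then show ?thesis using x all(1) 2(1) unfolding U_def by blast
    next
      case False
      then have "x < y" using 2 by auto
      then have "\<not> (1 < j \<and> y = junction \<beta> (2 * (j - 1)))"
        using junction_bounds(4)[of x "j - 1"] 2 by auto
      then have "j \<le> ell \<beta>" "y = junction \<beta> (2 * j - 1)"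
        using asc_shared_cases[OF 2(3,1)] False by auto
      then show ?thesis using top[of j] all(2) \<open>x < y\<close> 2(1) by auto
    qed
    show ?thesis
    proof (cases "x \<in> asc_unshared \<beta> j")
      case True
      then have xX: "x \<in> X j" using x UX 2(1) by blast
      then have "0 < b j" using X[OF 2(1)] finite_asc_unshared
        by (metis card_gt_0_iff empty_iff finite_subset)
      then have "0 < e j" if "j \<le> ell \<beta>" using code(2) 2(1) that by auto
      then show ?thesis using y xX X[OF 2(1)] 2(4) by blast
    next
      case False
      then consider "j \<le> ell \<beta>" "x = junction \<beta> (2 * j - 1)" | "1 < j" "x = junction \<beta> (2 * (j - 1))"
        using asc_shared_cases[OF 2(2,1)] by blast
      then show ?thesis
      proof cases
        case 1
        then have "x = y" using 2(4) junction_bounds(3)[OF 2(3)] by simp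
        then show ?thesis using x by simp
      next
        case c2: 2
        \<comment> \<open>Here \<open>x\<close> is the common minimum of \<open>D_i\<close> and
          \<open>A_j\<close>. Being the least element of \<open>D_i\<close>, it lies in
          \<open>Y i\<close> only if \<open>Y i\<close> is all of \<open>D_i\<close>, which brings
          in the condition on full entries.\<close>
        define i where "i = j - 1"
        have i: "i \<in> {1..ell \<beta>}" "j = i + 1" using c2 2(1) by (auto simp: i_def)
        have "x \<in> Y i" using UY[OF i(1)] x c2 junction_mem(2)[OF i(1)] by (auto simp: i_def)
        then have "desc \<beta> i \<subseteq> Y i"
          using Y[OF i(1)] junction_bounds(2)[of _ i] c2 by (auto simp: i_def)
        then have "Y i = desc \<beta> i" using Y[OF i(1)] by auto
        then have "e i = delta \<beta> i + 1" using Y[OF i(1)] card_desc[OF i(1)] by auto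
        then have b: "b j = cap \<beta> j" "i < ell \<beta> \<longrightarrow> 0 < e j" using code(2) i by auto
        then have "X j = asc_unshared \<beta> j"
          using X[OF 2(1)] by (intro card_subset_eq finite_asc_unshared) (auto simp: alpha_def)
        then show ?thesis using y b(2) i(2) by auto
      qed
    qed
  qed
  moreover have "U \<subseteq> fence \<beta>"
    unfolding U_def fence_eq_Un using X Y by (intro Un_mono UN_mono subset_refl) blast+
  ultimately have "U \<in> fence_filters \<beta>" unfolding fence_filters_def by blast
  then show ?thesis using enc by blast
qed

section \<open>Ideals through their complementary filters\<close>

lemma filter_of_ideal:
  assumes "I \<in> fence_ideals \<beta>"
  shows "fence \<beta> - I \<in> fence_filters \<beta>"
  using assms unfolding fence_ideals_def fence_filters_def by blast

lemma code_complement: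
  shows "j \<in> {1..ell \<beta> + 1} \<Longrightarrow> acode \<beta> (fence \<beta> - I) j + acode \<beta> I j = cap \<beta> j"
    and "i \<in> {1..ell \<beta>} \<Longrightarrow> dcode \<beta> (fence \<beta> - I) i + dcode \<beta> I i = delta \<beta> i + 1"
proof -
  have compl: "card ((fence \<beta> - I) \<inter> S) + card (I \<inter> S) = card S" if "S \<subseteq> fence \<beta>" for S
  proof -
    have "finite S" using that finite_fence finite_subset by blast
    moreover have "(fence \<beta> - I) \<inter> S = S - I" using that by blast
    ultimately show ?thesis
      by (metis Int_commute add.commute card_Int_Diff)
  qed
  show "acode \<beta> (fence \<beta> - I) j + acode \<beta> I j = cap \<beta> j" if "j \<in> {1..ell \<beta> + 1}"
    using compl[of "asc_unshared \<beta> j"] asc_subset_fence[OF that] asc_unshared_subset_asc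
    by (auto simp: acode_def alpha_def)
  show "dcode \<beta> (fence \<beta> - I) i + dcode \<beta> I i = delta \<beta> i + 1" if "i \<in> {1..ell \<beta>}"
    using compl[OF desc_subset_fence[OF that]] card_desc[OF that] by (simp add: dcode_def)
qed

text \<open>Complementing turns each entry into its difference from the maximum, so the conditions
  are the contrapositives of those for filters: \<open>d i = 0\<close> means that \<open>e i\<close>
  is full, and a full \<open>d i\<close> means \<open>e i = 0\<close>.\<close>

lemma ideal_code_of_ideal:
  assumes "I \<in> fence_ideals \<beta>"
  shows "ideal_code \<beta> (acode \<beta> I, dcode \<beta> I)"
proof -
  let ?b = "acode \<beta> (fence \<beta> - I)" and ?e = "dcode \<beta> (fence \<beta> - I)"
  have code: "?e i \<le> delta \<beta> i + 1 \<and> (0 < ?b i \<longrightarrow> 0 < ?e i) \<and>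
        (?e i = delta \<beta> i + 1 \<longrightarrow> ?b (i + 1) = cap \<beta> (i + 1) \<and> (i < ell \<beta> \<longrightarrow> 0 < ?e (i + 1)))"
    if "i \<in> {1..ell \<beta>}" for i
    using filter_code_of_filter[OF filter_of_ideal[OF assms]] that unfolding filter_code_def by auto
  note A = code_complement(1)[of _ I] and D = code_complement(2)[of _ I]
  have "acode \<beta> I j \<le> cap \<beta> j" if "j \<in> {1..ell \<beta> + 1}" for j
    using A[OF that] by linarith
  moreover have "dcode \<beta> I i \<le> delta \<beta> i + 1" if "i \<in> {1..ell \<beta>}" for i
    using D[OF that] by linarith
  moreover have "0 < dcode \<beta> I i" if "i \<in> {1..ell \<beta>}" "0 < acode \<beta> I (i + 1)" for i
  proof -
    have "i + 1 \<in> {1..ell \<beta> + 1}" using that(1) by simp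
    then show ?thesis using D[OF that(1)] A[of "i + 1"] code[OF that(1)] that(2) by linarith
  qed
  moreover have "acode \<beta> I i = cap \<beta> i" if "i \<in> {1..ell \<beta>}" "dcode \<beta> I i = delta \<beta> i + 1" for i
  proof -
    have "i \<in> {1..ell \<beta> + 1}" using that(1) by simp
    then show ?thesis using D[OF that(1)] A[of i] code[OF that(1)] that(2) by linarith
  qed
  moreover have "0 < dcode \<beta> I (i - 1)"
    if "i \<in> {1..ell \<beta>}" "dcode \<beta> I i = delta \<beta> i + 1" "1 < i" for i
  proof -
    have i: "i - 1 \<in> {1..ell \<beta>}" "i - 1 < ell \<beta>" "i - 1 + 1 = i" using that by auto
    then show ?thesis using D[OF that(1)] D[OF i(1)] code[OF i(1)] that(2) by (metis gr0I add_0_right less_irrefl add_eq_self_zero add.commute)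
  qed
  ultimately show ?thesis unfolding ideal_code_def by auto
qed

lemma ideal_eqI:
  assumes "I \<in> fence_ideals \<beta>" "J \<in> fence_ideals \<beta>"
    and "same_code \<beta> (acode \<beta> I, dcode \<beta> I) (acode \<beta> J, dcode \<beta> J)"
  shows "I = J"
proof -
  have eq: "\<forall>j\<in>{1..ell \<beta> + 1}. acode \<beta> I j = acode \<beta> J j" "\<forall>i\<in>{1..ell \<beta>}. dcode \<beta> I i = dcode \<beta> J i"
    using assms(3) unfolding same_code_def by auto
  have "acode \<beta> (fence \<beta> - I) j = acode \<beta> (fence \<beta> - J) j" if "j \<in> {1..ell \<beta> + 1}" for j
    using code_complement(1)[OF that, of I] code_complement(1)[OF that, of J] eq(1) that by simp
  moreover have "dcode \<beta> (fence \<beta> - I) i = dcode \<beta> (fence \<beta> - J) i" if "i \<in> {1..ell \<beta>}" for i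
    using code_complement(2)[OF that, of I] code_complement(2)[OF that, of J] eq(2) that by simp
  ultimately have "fence \<beta> - I = fence \<beta> - J"
    using assms by (intro filter_eqI filter_of_ideal) (auto simp: same_code_def)
  moreover have "I \<subseteq> fence \<beta>" "J \<subseteq> fence \<beta>" using assms unfolding fence_ideals_def by auto
  ultimately show ?thesis by blast
qed

lemma restricted_ideal_code_of_restricted_ideal:
  "restricted_ideal \<beta> I \<Longrightarrow> restricted_ideal_code \<beta> (acode \<beta> I, dcode \<beta> I)"
  unfolding restricted_ideal_def restricted_ideal_code_def using ideal_code_of_ideal by simp

text \<open>Justifies the definite description in \<open>Phi\<close>:
  \<open>ex_filter_with_code\<close> gives existence and \<open>filter_eqI\<close> uniqueness. Sizes
  agree because each of the three steps preserves \<open>code_size\<close>.\<close>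

lemma Phi_restricted:
  assumes "restricted_ideal \<beta> I"
  shows "restricted_filter \<beta> (Phi \<beta> I)" "card (Phi \<beta> I) = card I"
    and "same_code \<beta> (acode \<beta> (Phi \<beta> I), dcode \<beta> (Phi \<beta> I))
           (PH3 \<beta> (PH2 \<beta> (PH1 \<beta> (acode \<beta> I, dcode \<beta> I))))"
proof -
  let ?x = "(acode \<beta> I, dcode \<beta> I)"
  obtain b e where y: "PH3 \<beta> (PH2 \<beta> (PH1 \<beta> ?x)) = (b, e)" by fastforce
  have x: "restricted_ideal_code \<beta> ?x"
    by (rule restricted_ideal_code_of_restricted_ideal[OF assms])
  note x1 = PH1_code_PH1[OF x delta_pos]
  note x2 = PH2_code_PH2[OF x1 delta_pos]
  have code: "restricted_filter_code \<beta> (b, e)"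
    using restricted_filter_code_PH3[OF x2 delta_pos] unfolding y .
  have enc_iff: "encodes \<beta> U (b, e) \<longleftrightarrow> same_code \<beta> (acode \<beta> U, dcode \<beta> U) (b, e)" for U
    unfolding encodes_def same_code_def by auto
  obtain U where U: "U \<in> fence_filters \<beta>" "encodes \<beta> U (b, e)"
    using ex_filter_with_code[of b e] code unfolding restricted_filter_code_def by auto
  have uniq: "V = U" if "V \<in> fence_filters \<beta>" "encodes \<beta> V (b, e)" for V
    using U that by (intro filter_eqI) (auto simp: encodes_def same_code_def)
  have Phi: "Phi \<beta> I = U"
    unfolding Phi_def y
  proof (rule the_equality)
    show "U \<in> fence_filters \<beta> \<and> encodes \<beta> U (b, e)" using U by (rule conjI)
  next
    fix V assume "V \<in> fence_filters \<beta> \<and> encodes \<beta> V (b, e)"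
    then show "V = U" by (elim conjE) (rule uniq)
  qed
  show same: "same_code \<beta> (acode \<beta> (Phi \<beta> I), dcode \<beta> (Phi \<beta> I)) (PH3 \<beta> (PH2 \<beta> (PH1 \<beta> ?x)))"
    using U(2) unfolding y Phi enc_iff .
  have eq: "\<forall>j\<in>{1..ell \<beta> + 1}. acode \<beta> U j = b j" "\<forall>i\<in>{1..ell \<beta>}. dcode \<beta> U i = e i"
    using U(2) unfolding encodes_def by auto
  then show "restricted_filter \<beta> (Phi \<beta> I)"
    using U(1) code unfolding Phi restricted_filter_def restricted_filter_code_def by auto
  have "card U = code_size \<beta> (acode \<beta> U, dcode \<beta> U)"
    using U(1) by (intro card_eq_code_size) (auto simp: fence_filters_def)
  also have "\<dots> = code_size \<beta> (b, e)"
    using eq unfolding code_size_def prod.case by (intro arg_cong2[where f = "(+)"] sum.cong) auto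
  also have "\<dots> = code_size \<beta> ?x"
    unfolding y[symmetric] code_size_PH3 code_size_PH2[OF x1] code_size_PH1 ..
  also have "\<dots> = card I"
    using assms by (intro card_eq_code_size[symmetric]) (auto simp: restricted_ideal_def fence_ideals_def)
  finally show "card (Phi \<beta> I) = card I" unfolding Phi .
qed

lemma Phi_inj:
  assumes "restricted_ideal \<beta> I" "restricted_ideal \<beta> J" "Phi \<beta> I = Phi \<beta> J"
  shows "I = J"
proof -
  let ?x = "(acode \<beta> I, dcode \<beta> I)" and ?y = "(acode \<beta> J, dcode \<beta> J)"
  have x: "restricted_ideal_code \<beta> ?x" "restricted_ideal_code \<beta> ?y"
    using restricted_ideal_code_of_restricted_ideal assms by blast+
  have x1: "PH1_code \<beta> (PH1 \<beta> ?x)" "PH1_code \<beta> (PH1 \<beta> ?y)"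
    using PH1_code_PH1[OF _ delta_pos] x by blast+
  have x2: "PH2_code \<beta> (PH2 \<beta> (PH1 \<beta> ?x))" "PH2_code \<beta> (PH2 \<beta> (PH1 \<beta> ?y))"
    using PH2_code_PH2[OF _ delta_pos] x1 by blast+
  have I: "I \<in> fence_ideals \<beta>" "J \<in> fence_ideals \<beta>" using assms unfolding restricted_ideal_def by auto
  have "same_code \<beta> (PH3 \<beta> (PH2 \<beta> (PH1 \<beta> ?x))) (PH3 \<beta> (PH2 \<beta> (PH1 \<beta> ?y)))"
    using Phi_restricted(3)[OF assms(1)] Phi_restricted(3)[OF assms(2)] assms(3)
    unfolding same_code_def by (auto split: prod.splits)
  then have "same_code \<beta> ?x ?y"
    using PH1_inj PH2_inj PH3_inj x1 x2 ideal_code_of_ideal I by blast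
  then show ?thesis using ideal_eqI I by blast
qed

lemma Phi_inj_on: "inj_on (Phi \<beta>) (restricted_ideals \<beta> k)"
  using Phi_inj by (auto simp: inj_on_def restricted_ideals_def)

lemma Phi_image_subset: "Phi \<beta> ` restricted_ideals \<beta> k \<subseteq> restricted_filters \<beta> k"
  using Phi_restricted by (auto simp: restricted_ideals_def restricted_filters_def)

end

end

section \<open>Turning the fence by 180 degrees\<close>

text \<open>Elements of the fence are numbered up to \<open>sum_list \<beta>\<close>, so the
  subtraction does not truncate there and \<open>reflect (rev \<beta>)\<close> is the
  inverse.\<close>

definition reflect :: "nat list \<Rightarrow> nat \<Rightarrow> nat" where
  "reflect \<beta> x = sum_list \<beta> - x"

lemma junction_le_sum_list: "junction \<beta> i \<le> sum_list \<beta>"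
  unfolding junction_def by (metis append_take_drop_id le_add1 sum_list_append)

lemma junction_rev:
  assumes "i \<le> length \<beta>"
  shows "junction (rev \<beta>) i = sum_list \<beta> - junction \<beta> (length \<beta> - i)"
proof -
  have "sum_list (take (length \<beta> - i) \<beta>) + sum_list (drop (length \<beta> - i) \<beta>) = sum_list \<beta>"
    by (metis append_take_drop_id sum_list_append)
  then show ?thesis
    unfolding junction_def take_rev sum_list_rev by simp
qed

lemma reflect_image_interval:
  assumes "u \<le> v" "v \<le> sum_list \<beta>"
  shows "reflect \<beta> ` {u..v} = {sum_list \<beta> - v..sum_list \<beta> - u}"
proof
  show "reflect \<beta> ` {u..v} \<subseteq> {sum_list \<beta> - v..sum_list \<beta> - u}"
    by (auto simp: reflect_def)
  show "{sum_list \<beta> - v..sum_list \<beta> - u} \<subseteq> reflect \<beta> ` {u..v}"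
  proof
    fix x assume "x \<in> {sum_list \<beta> - v..sum_list \<beta> - u}"
    then show "x \<in> reflect \<beta> ` {u..v}"
      using assms by (intro image_eqI[of _ _ "sum_list \<beta> - x"]) (auto simp: reflect_def)
  qed
qed

lemma reflect_segment:
  assumes "k \<in> {1..length \<beta>}"
  shows "segment (rev \<beta>) (length \<beta> + 1 - k) = reflect \<beta> ` segment \<beta> k"
proof -
  have *: "length \<beta> + 1 - k - 1 = length \<beta> - k" "length \<beta> - (length \<beta> - k) = k"
    "length \<beta> - (length \<beta> + 1 - k) = k - 1" "length \<beta> + 1 - k \<le> length \<beta>"
    using assms by auto
  have "segment (rev \<beta>) (length \<beta> + 1 - k)
      = {sum_list \<beta> - junction \<beta> k..sum_list \<beta> - junction \<beta> (k - 1)}"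
    unfolding segment_def junction_rev[OF *(4)] *(1) junction_rev[OF diff_le_self] *(2,3) ..
  also have "\<dots> = reflect \<beta> ` segment \<beta> k"
    unfolding segment_def
    by (rule reflect_image_interval[symmetric]) (auto intro: junction_mono junction_le_sum_list)
  finally show ?thesis .
qed

lemma reflect_index: "k \<in> {1..length \<beta>} \<Longrightarrow> length \<beta> + 1 - k \<in> {1..length (rev \<beta>)}"
  by auto

lemma segment_le_sum_list: "x \<in> segment \<beta> k \<Longrightarrow> x \<le> sum_list \<beta>"
  using junction_le_sum_list[of \<beta> k] by (auto simp: segment_def)

lemma fence_le_sum_list: "x \<in> fence \<beta> \<Longrightarrow> x \<le> sum_list \<beta>"
  by (auto simp: fence_def segment_le_sum_list)

lemma reflect_reflect: "x \<le> sum_list \<beta> \<Longrightarrow> reflect (rev \<beta>) (reflect \<beta> x) = x"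
  by (simp add: reflect_def)

lemma inj_on_reflect: "inj_on (reflect \<beta>) (fence \<beta>)"
  by (rule inj_on_inverseI[of _ "reflect (rev \<beta>)"]) (simp add: reflect_reflect fence_le_sum_list)

lemma fence_rev_subset: "reflect \<beta> ` fence \<beta> \<subseteq> fence (rev \<beta>)"
proof
  fix y assume "y \<in> reflect \<beta> ` fence \<beta>"
  then obtain x k where "y = reflect \<beta> x" "k \<in> {1..length \<beta>}" "x \<in> segment \<beta> k"
    by (auto simp: fence_def)
  then show "y \<in> fence (rev \<beta>)"
    using reflect_segment[of k \<beta>] reflect_index[of k \<beta>] unfolding fence_def by blast
qed

lemma shared_reflect:
  assumes "shared \<beta> x"
  shows "shared (rev \<beta>) (reflect \<beta> x)"
proof -
  obtain i i' where i: "i \<in> {1..length \<beta>}" "i' \<in> {1..length \<beta>}" "i \<noteq> i'"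
    "x \<in> segment \<beta> i" "x \<in> segment \<beta> i'"
    using assms unfolding shared_def by blast
  have "length \<beta> + 1 - i \<noteq> length \<beta> + 1 - i'" using i by auto
  then show ?thesis
    unfolding shared_def
    using reflect_index[OF i(1)] reflect_index[OF i(2)] reflect_segment[OF i(1)]
      reflect_segment[OF i(2)] i(4,5) by blast
qed

lemma shared_reflect_iff:
  assumes "x \<le> sum_list \<beta>"
  shows "shared (rev \<beta>) (reflect \<beta> x) \<longleftrightarrow> shared \<beta> x"
  using shared_reflect[of \<beta> x] shared_reflect[of "rev \<beta>" "reflect \<beta> x"] reflect_reflect[OF assms]
  by auto

text \<open>As the number of segments is odd, a segment and its image have indices of the same
  parity, while the numbering is reversed. So the order is reversed too.\<close>

lemma fence_le_reflect:
  assumes "fence_le \<beta> x y" "odd (length \<beta>)"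
  shows "fence_le (rev \<beta>) (reflect \<beta> y) (reflect \<beta> x)"
proof -
  obtain k where k: "k \<in> {1..length \<beta>}" "x \<in> segment \<beta> k" "y \<in> segment \<beta> k"
    "if odd k then x \<le> y else y \<le> x"
    using assms(1) unfolding fence_le_def by blast
  have "odd (length \<beta> + 1 - k) \<longleftrightarrow> odd k" using assms(2) k(1) by auto
  moreover have "reflect \<beta> x \<in> segment (rev \<beta>) (length \<beta> + 1 - k)"
    "reflect \<beta> y \<in> segment (rev \<beta>) (length \<beta> + 1 - k)"
    using reflect_segment[OF k(1)] k(2,3) by auto
  moreover have "if odd k then reflect \<beta> y \<le> reflect \<beta> x else reflect \<beta> x \<le> reflect \<beta> y"
    using k(4) by (auto simp: reflect_def diff_le_mono2 split: if_splits)
  ultimately show ?thesis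
    unfolding fence_le_def using reflect_index[OF k(1)] by (intro bexI[of _ "length \<beta> + 1 - k"]) auto
qed

lemma ideal_reflect_filter:
  assumes "U \<in> fence_filters \<beta>" "odd (length \<beta>)"
  shows "reflect \<beta> ` U \<in> fence_ideals (rev \<beta>)"
proof -
  have U: "U \<subseteq> fence \<beta>" and up: "\<And>x y. x \<in> U \<Longrightarrow> y \<in> fence \<beta> \<Longrightarrow> fence_le \<beta> x y \<Longrightarrow> y \<in> U"
    using assms unfolding fence_filters_def by auto
  have "x \<in> reflect \<beta> ` U"
    if u: "u \<in> U" and x: "x \<in> fence (rev \<beta>)" and le: "fence_le (rev \<beta>) x (reflect \<beta> u)" for u x
  proof -
    have xx: "reflect \<beta> (reflect (rev \<beta>) x) = x"
      using reflect_reflect[of x "rev \<beta>"] fence_le_sum_list[OF x] by simp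
    have uu: "reflect (rev \<beta>) (reflect \<beta> u) = u"
      using reflect_reflect[of u \<beta>] fence_le_sum_list[of u \<beta>] u U by auto
    have "fence_le \<beta> u (reflect (rev \<beta>) x)"
      using fence_le_reflect[OF le] assms(2) uu by simp
    moreover have "reflect (rev \<beta>) x \<in> fence \<beta>"
      using fence_rev_subset[of "rev \<beta>"] x by auto
    ultimately have "reflect (rev \<beta>) x \<in> U" using up[OF u] by blast
    then show ?thesis using xx by (metis image_eqI)
  qed
  then show ?thesis
    using U fence_rev_subset[of \<beta>] unfolding fence_ideals_def by blast
qed

lemma ell_rev: "ell (rev \<beta>) = ell \<beta>"
  by (simp add: ell_def)

context
  fixes \<beta> :: "nat list"
  assumes odd_length: "odd (length \<beta>)"
begin

lemma desc_reflect:
  assumes "i \<in> {1..ell \<beta>}"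
  shows "desc (rev \<beta>) (ell \<beta> + 1 - i) = reflect \<beta> ` desc \<beta> i"
proof -
  have "2 * (ell \<beta> + 1 - i) = length \<beta> + 1 - 2 * i" "2 * i \<in> {1..length \<beta>}"
    using assms length_eq[OF odd_length] by auto
  then show ?thesis unfolding desc_def using reflect_segment by metis
qed

lemma asc_reflect:
  assumes "j \<in> {1..ell \<beta> + 1}"
  shows "asc (rev \<beta>) (ell \<beta> + 2 - j) = reflect \<beta> ` asc \<beta> j"
proof -
  have "2 * (ell \<beta> + 2 - j) - 1 = length \<beta> + 1 - (2 * j - 1)" "2 * j - 1 \<in> {1..length \<beta>}"
    using assms length_eq[OF odd_length] by auto
  then show ?thesis unfolding asc_def using reflect_segment by metis
qed

lemma asc_unshared_reflect:
  assumes "j \<in> {1..ell \<beta> + 1}"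
  shows "asc_unshared (rev \<beta>) (ell \<beta> + 2 - j) = reflect \<beta> ` asc_unshared \<beta> j"
proof -
  have "x \<le> sum_list \<beta>" if "x \<in> asc \<beta> j" for x
    using that segment_le_sum_list unfolding asc_def by blast
  then show ?thesis
    unfolding asc_unshared_def asc_reflect[OF assms] using shared_reflect_iff by blast
qed

lemma card_reflect_Int:
  assumes "X \<subseteq> fence \<beta>" "Y \<subseteq> fence \<beta>"
  shows "card (reflect \<beta> ` X \<inter> reflect \<beta> ` Y) = card (X \<inter> Y)"
proof -
  have "reflect \<beta> ` X \<inter> reflect \<beta> ` Y = reflect \<beta> ` (X \<inter> Y)"
    using inj_on_image_Int[OF inj_on_reflect assms] by simp
  moreover have "inj_on (reflect \<beta>) (X \<inter> Y)"
    using inj_on_subset[OF inj_on_reflect] assms by blast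
  ultimately show ?thesis by (simp add: card_image)
qed

lemma acode_reflect:
  "X \<subseteq> fence \<beta> \<Longrightarrow> j \<in> {1..ell \<beta> + 1} \<Longrightarrow>
     acode (rev \<beta>) (reflect \<beta> ` X) (ell \<beta> + 2 - j) = acode \<beta> X j"
  unfolding acode_def using asc_unshared_reflect card_reflect_Int asc_unshared_subset_fence[OF odd_length] by simp

lemma dcode_reflect:
  "X \<subseteq> fence \<beta> \<Longrightarrow> i \<in> {1..ell \<beta>} \<Longrightarrow>
     dcode (rev \<beta>) (reflect \<beta> ` X) (ell \<beta> + 1 - i) = dcode \<beta> X i"
  unfolding dcode_def using desc_reflect card_reflect_Int desc_subset_fence[OF odd_length] by simp

lemma alpha_reflect:
  assumes "j \<in> {1..ell \<beta> + 1}"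
  shows "alpha (rev \<beta>) (ell \<beta> + 2 - j) = alpha \<beta> j"
  unfolding alpha_def asc_unshared_reflect[OF assms]
  using inj_on_subset[OF inj_on_reflect asc_unshared_subset_fence[OF odd_length assms]] by (simp add: card_image)

lemma delta_reflect:
  assumes "i \<in> {1..ell \<beta>}"
  shows "delta (rev \<beta>) (ell \<beta> + 1 - i) = delta \<beta> i"
proof -
  have "2 * (ell \<beta> + 1 - i) - 1 < length \<beta>" "length \<beta> - Suc (2 * (ell \<beta> + 1 - i) - 1) = 2 * i - 1"
    using assms length_eq[OF odd_length] by auto
  then show ?thesis by (simp add: delta_def rev_nth)
qed

text \<open>The descending segments \<open>1\<close> and \<open>ell \<beta>\<close> change places,
  as do the ascending segments \<open>1\<close> and \<open>ell \<beta> + 1\<close>. This carries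
  each of the two conditions on filters to the corresponding one on ideals.\<close>

lemma restricted_ideal_reflect:
  assumes "restricted_filter \<beta> U"
  shows "restricted_ideal (rev \<beta>) (reflect \<beta> ` U)"
proof -
  have U: "U \<in> fence_filters \<beta>" "U \<subseteq> fence \<beta>"
    using assms unfolding restricted_filter_def fence_filters_def by auto
  show ?thesis
  proof (cases "1 \<le> ell \<beta>")
    case True
    then have "ell \<beta> \<in> {1..ell \<beta>}" "1 \<in> {1..ell \<beta>}" "1 \<in> {1..ell \<beta> + 1}" by auto
    then show ?thesis
      using assms ideal_reflect_filter[OF U(1) odd_length]
        dcode_reflect[OF U(2), of 1] dcode_reflect[OF U(2), of "ell \<beta>"]
        acode_reflect[OF U(2), of 1] alpha_reflect[of 1] delta_reflect[of "ell \<beta>"]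
      unfolding restricted_ideal_def restricted_filter_def ell_rev by simp
  next
    case False
    then show ?thesis
      using ideal_reflect_filter[OF U(1) odd_length] unfolding restricted_ideal_def ell_rev by blast
  qed
qed

end

lemma card_restricted_filters_le:
  assumes "odd (length \<beta>)"
  shows "card (restricted_filters \<beta> k) \<le> card (restricted_ideals (rev \<beta>) k)"
proof (rule card_inj_on_le)
  have sub: "U \<subseteq> fence \<beta>" if "U \<in> restricted_filters \<beta> k" for U
    using that unfolding restricted_filters_def restricted_filter_def fence_filters_def by blast
  show "inj_on ((`) (reflect \<beta>)) (restricted_filters \<beta> k)"
    by (rule inj_onI) (metis inj_on_image_eq_iff inj_on_reflect sub)
  have "card (reflect \<beta> ` U) = card U" if "U \<in> restricted_filters \<beta> k" for U
    by (intro card_image inj_on_subset[OF inj_on_reflect] sub that)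
  then show "(`) (reflect \<beta>) ` restricted_filters \<beta> k \<subseteq> restricted_ideals (rev \<beta>) k"
    using restricted_ideal_reflect[OF assms] by (auto simp: restricted_filters_def restricted_ideals_def)
  show "finite (restricted_ideals (rev \<beta>) k)"
    by (rule finite_restricted_ideals)
qed

lemma card_restricted_ideals_le:
  assumes "\<forall>x\<in>set \<beta>. 0 < x" "odd (length \<beta>)"
  shows "card (restricted_ideals \<beta> k) \<le> card (restricted_filters \<beta> k)"
  using Phi_inj_on[OF assms(2,1)] Phi_image_subset[OF assms(2,1)] finite_restricted_filters
  by (rule card_inj_on_le)

theorem theorem4p1:
  fixes \<beta> :: "nat list" and k :: nat
  assumes "\<forall>x\<in>set \<beta>. 0 < x" and "odd (length \<beta>)"
  shows "bij_betw (Phi \<beta>) (restricted_ideals \<beta> k) (restricted_filters \<beta> k)"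
proof -
  have rev: "\<forall>x\<in>set (rev \<beta>). 0 < x" "odd (length (rev \<beta>))" using assms by auto
  \<comment> \<open>The chain is reflection, \<open>Phi\<close> for \<open>rev \<beta>\<close>, and
    reflection back to \<open>rev (rev \<beta>) = \<beta>\<close>. Injections suffice in all three
    places.\<close>
  have "card (restricted_filters \<beta> k) \<le> card (restricted_ideals (rev \<beta>) k)"
    by (rule card_restricted_filters_le[OF assms(2)])
  also have "\<dots> \<le> card (restricted_filters (rev \<beta>) k)"
    by (rule card_restricted_ideals_le[OF rev])
  also have "\<dots> \<le> card (restricted_ideals \<beta> k)"
    using card_restricted_filters_le[OF rev(2)] by simp
  also have "\<dots> = card (Phi \<beta> ` restricted_ideals \<beta> k)"
    by (rule card_image[OF Phi_inj_on[OF assms(2,1)], symmetric])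
  finally have "Phi \<beta> ` restricted_ideals \<beta> k = restricted_filters \<beta> k"
    by (rule card_seteq[OF finite_restricted_filters Phi_image_subset[OF assms(2,1)]])
  then show ?thesis using Phi_inj_on[OF assms(2,1)] by (simp add: bij_betw_def)
qed

end
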